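(* Let $(\mathcal{A},\varphi,\varphi^\prime)$ be an infinitesimal non-commutative probability space and let $\tilde r_n=r_n+\hbar r^\prime_n$, $\tilde b_n=b_n+\hbar b^\prime_n$, $\tilde h_n=h_n+\hbar h^\prime_n$ be its $\mathbb{G}$-valued free, Boolean and monotone cumulants. Then for every $n$ and $a_1,\dots,a_n\in\mathcal{A}$: \begin{align*} \tilde b_n(a_1,\dots,a_n)&=\sum_{\pi\in\mathcal{NC}_{irr}(n)}\tilde r_\pi(a_1,\dots,a_n),\\ \tilde r_n(a_1,\dots,a_n)&=\sum_{\pi\in\mathcal{NC}_{irr}(n)}(-1)^{|\pi|-1}\tilde b_\pi(a_1,\dots,a_n),\\ \tilde b_n(a_1,\dots,a_n)&=\sum_{\pi\in\mathcal{NC}_{irr}(n)}\frac{1}{\tau(\pi)!}\tilde h_\pi(a_1,\dots,a_n),\\ \tilde r_n(a_1,\dots,a_n)&=\sum_{\pi\in\mathcal{NC}_{irr}(n)}\frac{(-1)^{|\pi|-1}}{\tau(\pi)!}\tilde h_\pi(a_1,\dots,a_n). \end{align*}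
   Context: An infinitesimal non-commutative probability space is $(\mathcal{A},\varphi,\varphi^\prime)$ with $\mathcal{A}$ a unital complex algebra, $\varphi,\varphi^\prime:\mathcal{A}\to\mathbb{C}$ linear, $\varphi(1)=1$, $\varphi^\prime(1)=0$; $\varphi_n(a_1,\dots,a_n)=\varphi(a_1\cdots a_n)$, $\varphi^\prime_n$ similarly. $\mathbb{G}=\{z+\hbar w:z,w\in\mathbb{C}\}$ is the commutative algebra with $\hbar^2=0$. $\mathcal{NC}(n)$, $\mathcal{I}(n)$ are the non-crossing and interval partitions of $[n]$; $\mathcal{NC}_{irr}(n)$ the non-crossing partitions with $1,n$ in the same block; $|\pi|$ the number of blocks; $\tau(\pi)!=\prod_{V\in\pi}N(V)$ with $N(V)$ the number of blocks $W\subseteq\{\min V,\dots,\max V\}$. For maps $f_m$, $f_\pi(a_1,\dots,a_n)=\prod_{V\in\pi}f_{|V|}(a_V)$ ($a_V$ = entries indexed by $V$ in increasing order) and $\partial f_\pi=\sum_{V\in\pi}f^\prime_{|V|}(a_V)\prod_{W\ne V}f_{|W|}(a_W)$. Cumulants: $\varphi_n=\sum_{\mathcal{NC}(n)}r_\pi=\sum_{\mathcal{I}(n)}b_\pi=\sum_{\mathcal{NC}(n)}\frac1{\tau(\pi)!}h_\pi$ and $\varphi^\prime_n=\sum_{\mathcal{NC}(n)}\partial r_\pi=\sum_{\mathcal{I}(n)}\partial b_\pi=\sum_{\mathcal{NC}(n)}\frac1{\tau(\pi)!}\partial h_\pi$ (recursive definitions of $r_n,b_n,h_n,r^\prime_n,b^\prime_n,h^\prime_n$).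 For $\mathbb{G}$-valued $\tilde f_m$, $\tilde f_\pi(a_1,\dots,a_n)=\prod_{V\in\pi}\tilde f_{|V|}(a_V)$, product in $\mathbb{G}$. *)

theory Defs
  imports Complex_Main "HOL-Library.Disjoint_Sets"
begin

section \<open>Infinitesimal non-commutative probability spaces\<close>

text \<open>The library has no class of complex algebras, so the scalar multiplication is a parameter.\<close>

locale infinitesimal_ncps = vector_space scale
  for scale :: "complex \<Rightarrow> 'a::ring_1 \<Rightarrow> 'a" +
  fixes \<phi> \<phi>' :: "'a \<Rightarrow> complex"
  assumes scale_mult_left: "scale c x * y = scale c (x * y)"
    and scale_mult_right: "x * scale c y = scale c (x * y)"
    and linear_phi: "Vector_Spaces.linear scale (*) \<phi>"
    and linear_phi': "Vector_Spaces.linear scale (*) \<phi>'"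
    and phi_one: "\<phi> 1 = 1"
    and phi'_one: "\<phi>' 1 = 0"


section \<open>The algebra of dual numbers\<close>

text \<open>\<open>Dual z w\<close> stands for \<open>z + hbar w\<close>; see \<open>Dual_eq\<close> and \<open>hbar_square\<close> below.\<close>

datatype dual = Dual (std: complex) (infin: complex)

instantiation dual :: comm_ring_1
begin

definition "0 = Dual 0 0"
definition "1 = Dual 1 0"
definition "x + y = Dual (std x + std y) (infin x + infin y)"
definition "- x = Dual (- std x) (- infin x)"
definition "x - y = Dual (std x - std y) (infin x - infin y)"
definition "x * y = Dual (std x * std y) (std x * infin y + infin x * std y)"

instance
  by standard
    (simp_all add: zero_dual_def one_dual_def plus_dual_def uminus_dual_def minus_dual_def
      times_dual_def algebra_simps)

end

definition of_complex :: "complex \<Rightarrow> dual" where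
  "of_complex z = Dual z 0"

definition hbar :: dual where
  "hbar = Dual 0 1"

lemma Dual_eq: "Dual z w = of_complex z + hbar * of_complex w"
  by (simp add: of_complex_def hbar_def plus_dual_def times_dual_def)

lemma hbar_square: "hbar * hbar = 0"
  by (simp add: hbar_def times_dual_def zero_dual_def)


section \<open>Non-crossing and interval partitions of \<open>{1..n}\<close>\<close>

definition NC :: "nat \<Rightarrow> nat set set set" where
  "NC n = {\<pi>. partition_on {1..n} \<pi> \<and>
     \<not> (\<exists>V\<in>\<pi>. \<exists>W\<in>\<pi>. V \<noteq> W \<and>
          (\<exists>i j k l. i < j \<and> j < k \<and> k < l \<and> i \<in> V \<and> k \<in> V \<and> j \<in> W \<and> l \<in> W))}"

definition NC_irr :: "nat \<Rightarrow> nat set set set" where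
  "NC_irr n = {\<pi>\<in>NC n. \<exists>V\<in>\<pi>. 1 \<in> V \<and> n \<in> V}"

definition interval_partitions :: "nat \<Rightarrow> nat set set set" where
  "interval_partitions n = {\<pi>. partition_on {1..n} \<pi> \<and> (\<forall>V\<in>\<pi>. \<exists>i j. V = {i..j})}"

definition tree_factorial :: "nat set set \<Rightarrow> nat" where
  "tree_factorial \<pi> = (\<Prod>V\<in>\<pi>. card {W\<in>\<pi>. W \<subseteq> {Min V..Max V}})"


section \<open>Multiplicative extension to partitions\<close>

text \<open>
  A family of maps \<open>f\<^sub>m\<close>, where \<open>f\<^sub>m\<close> takes \<open>m\<close> arguments, is encoded as one function \<open>f\<close> on lists;
  \<open>f\<^sub>m\<close> is its restriction to lists of length \<open>m\<close>. The entries of a list are numbered from 1.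
\<close>

definition entries :: "'a list \<Rightarrow> nat set \<Rightarrow> 'a list" where
  "entries xs V = map (\<lambda>i. xs ! (i - 1)) (sorted_list_of_set V)"

definition mult_ext :: "('a list \<Rightarrow> 'b::comm_monoid_mult) \<Rightarrow> nat set set \<Rightarrow> 'a list \<Rightarrow> 'b" where
  "mult_ext f \<pi> xs = (\<Prod>V\<in>\<pi>. f (entries xs V))"

definition partial_ext ::
    "('a list \<Rightarrow> 'b::comm_semiring_1) \<Rightarrow> ('a list \<Rightarrow> 'b) \<Rightarrow> nat set set \<Rightarrow> 'a list \<Rightarrow> 'b" where
  "partial_ext f f' \<pi> xs =
     (\<Sum>V\<in>\<pi>. f' (entries xs V) * (\<Prod>W\<in>\<pi> - {V}. f (entries xs W)))"

lemma mult_ext_cong [fundef_cong]: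
  assumes "\<pi> = \<pi>2" "xs = xs2" "\<And>V. V \<in> \<pi>2 \<Longrightarrow> f (entries xs2 V) = g (entries xs2 V)"
  shows "mult_ext f \<pi> xs = mult_ext g \<pi>2 xs2"
  unfolding mult_ext_def using assms by (auto intro: prod.cong)

lemma partial_ext_cong [fundef_cong]:
  assumes "\<pi> = \<pi>2" "xs = xs2" "\<And>V. V \<in> \<pi>2 \<Longrightarrow> f (entries xs2 V) = g (entries xs2 V)"
    "\<And>V. V \<in> \<pi>2 \<Longrightarrow> f' (entries xs2 V) = g' (entries xs2 V)"
  shows "partial_ext f f' \<pi> xs = partial_ext g g' \<pi>2 xs2"
proof -
  have "(\<Prod>W\<in>\<pi>2 - {V}. f (entries xs2 W)) = (\<Prod>W\<in>\<pi>2 - {V}. g (entries xs2 W))" for V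
    using assms(3) by (intro prod.cong) auto
  then show ?thesis
    unfolding partial_ext_def using assms(1,2,4) by (auto intro: sum.cong)
qed

lemma length_entries_less:
  assumes part: "partition_on {1..length xs} \<pi>" and ne: "\<pi> \<noteq> {{1..length xs}}" and V: "V \<in> \<pi>"
  shows "length (entries xs V) < length xs"
proof -
  have sub: "V \<subseteq> {1..length xs}"
    using part V by (auto simp: partition_on_def)
  have "V \<noteq> {1..length xs}"
  proof
    assume eq: "V = {1..length xs}"
    have "W = V" if W: "W \<in> \<pi>" for W
    proof (rule ccontr)
      assume "W \<noteq> V"
      then have "W \<inter> V = {}"
        using part V W by (auto simp: partition_on_def disjoint_def)
      moreover have "W \<subseteq> V" "W \<noteq> {}"
        using part W eq by (auto simp: partition_on_def)
      ultimately show False by auto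
    qed
    then show False using V eq ne by blast
  qed
  then have "card V < card {1..length xs}"
    using sub by (intro psubset_card_mono) auto
  then show ?thesis by (simp add: entries_def)
qed

lemma NC_partition_on: "\<pi> \<in> NC n \<Longrightarrow> partition_on {1..n} \<pi>"
  by (simp add: NC_def)

lemma interval_partition_on: "\<pi> \<in> interval_partitions n \<Longrightarrow> partition_on {1..n} \<pi>"
  by (simp add: interval_partitions_def)


section \<open>Cumulants\<close>

text \<open>
  Each function solves its moment-cumulant formula for the term of the one-block partition,
  whose coefficient is 1; the formulas themselves are the lemmas at the end of this section.
\<close>

function free_cumulant :: "('a::ring_1 \<Rightarrow> complex) \<Rightarrow> 'a list \<Rightarrow> complex" where
  "free_cumulant \<phi> xs = \<phi> (prod_list xs) -
     (\<Sum>\<pi>\<in>NC (length xs) - {{{1..length xs}}}. mult_ext (free_cumulant \<phi>) \<pi> xs)"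
  by pat_completeness auto
termination
  by (relation "measure (\<lambda>(_, xs). length xs)") (auto intro!: length_entries_less NC_partition_on)

declare free_cumulant.simps [simp del]

function boolean_cumulant :: "('a::ring_1 \<Rightarrow> complex) \<Rightarrow> 'a list \<Rightarrow> complex" where
  "boolean_cumulant \<phi> xs = \<phi> (prod_list xs) -
     (\<Sum>\<pi>\<in>interval_partitions (length xs) - {{{1..length xs}}}.
        mult_ext (boolean_cumulant \<phi>) \<pi> xs)"
  by pat_completeness auto
termination
  by (relation "measure (\<lambda>(_, xs). length xs)")
    (auto intro!: length_entries_less interval_partition_on)

declare boolean_cumulant.simps [simp del]

function monotone_cumulant :: "('a::ring_1 \<Rightarrow> complex) \<Rightarrow> 'a list \<Rightarrow> complex" where
  "monotone_cumulant \<phi> xs = \<phi> (prod_list xs) -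
     (\<Sum>\<pi>\<in>NC (length xs) - {{{1..length xs}}}.
        1 / of_nat (tree_factorial \<pi>) * mult_ext (monotone_cumulant \<phi>) \<pi> xs)"
  by pat_completeness auto
termination
  by (relation "measure (\<lambda>(_, xs). length xs)") (auto intro!: length_entries_less NC_partition_on)

declare monotone_cumulant.simps [simp del]

function inf_free_cumulant ::
    "('a::ring_1 \<Rightarrow> complex) \<Rightarrow> ('a \<Rightarrow> complex) \<Rightarrow> 'a list \<Rightarrow> complex" where
  "inf_free_cumulant \<phi> \<phi>' xs = \<phi>' (prod_list xs) -
     (\<Sum>\<pi>\<in>NC (length xs) - {{{1..length xs}}}.
        partial_ext (free_cumulant \<phi>) (inf_free_cumulant \<phi> \<phi>') \<pi> xs)"
  by pat_completeness auto
termination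
  by (relation "measure (\<lambda>(_, _, xs). length xs)")
    (auto intro!: length_entries_less NC_partition_on)

declare inf_free_cumulant.simps [simp del]

function inf_boolean_cumulant ::
    "('a::ring_1 \<Rightarrow> complex) \<Rightarrow> ('a \<Rightarrow> complex) \<Rightarrow> 'a list \<Rightarrow> complex" where
  "inf_boolean_cumulant \<phi> \<phi>' xs = \<phi>' (prod_list xs) -
     (\<Sum>\<pi>\<in>interval_partitions (length xs) - {{{1..length xs}}}.
        partial_ext (boolean_cumulant \<phi>) (inf_boolean_cumulant \<phi> \<phi>') \<pi> xs)"
  by pat_completeness auto
termination
  by (relation "measure (\<lambda>(_, _, xs). length xs)")
    (auto intro!: length_entries_less interval_partition_on)

declare inf_boolean_cumulant.simps [simp del]

function inf_monotone_cumulant ::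
    "('a::ring_1 \<Rightarrow> complex) \<Rightarrow> ('a \<Rightarrow> complex) \<Rightarrow> 'a list \<Rightarrow> complex" where
  "inf_monotone_cumulant \<phi> \<phi>' xs = \<phi>' (prod_list xs) -
     (\<Sum>\<pi>\<in>NC (length xs) - {{{1..length xs}}}.
        1 / of_nat (tree_factorial \<pi>) *
        partial_ext (monotone_cumulant \<phi>) (inf_monotone_cumulant \<phi> \<phi>') \<pi> xs)"
  by pat_completeness auto
termination
  by (relation "measure (\<lambda>(_, _, xs). length xs)")
    (auto intro!: length_entries_less NC_partition_on)

declare inf_monotone_cumulant.simps [simp del]

lemma entries_all [simp]: "entries xs {1..length xs} = xs"
proof -
  have "sorted_list_of_set {1..length xs} = [1..<Suc (length xs)]"
    by (metis atLeastLessThanSuc_atLeastAtMost sorted_list_of_set_range)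
  then show ?thesis
    unfolding entries_def by (auto intro!: nth_equalityI simp del: upt_Suc)
qed

lemma mult_ext_one_block [simp]: "mult_ext f {{1..length xs}} xs = f xs"
  using entries_all[of xs] by (simp add: mult_ext_def)

lemma partial_ext_one_block [simp]: "partial_ext f f' {{1..length xs}} xs = f' xs"
  using entries_all[of xs] by (simp add: partial_ext_def)

lemma tree_factorial_one_block [simp]:
  assumes "n \<ge> 1"
  shows "tree_factorial {{1..n}} = 1"
proof -
  have "Min {1..n} = 1" "Max {1..n} = n"
    using assms by (auto intro!: Min_eqI Max_eqI)
  then have "{W \<in> {{1..n}}. W \<subseteq> {Min {1..n}..Max {1..n}}} = {{1..n}}"
    by auto
  then show ?thesis by (simp add: tree_factorial_def)
qed

lemma one_block_partition_on: "n \<ge> 1 \<Longrightarrow> partition_on {1..n} {{1..n::nat}}"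
  by (rule partition_on_space) auto

lemma one_block_NC: "n \<ge> 1 \<Longrightarrow> {{1..n}} \<in> NC n"
  using one_block_partition_on[of n] by (simp add: NC_def)

lemma one_block_interval: "n \<ge> 1 \<Longrightarrow> {{1..n}} \<in> interval_partitions n"
  using one_block_partition_on[of n] by (auto simp: interval_partitions_def)

lemma finite_NC [simp]: "finite (NC n)"
  by (rule finite_subset[of _ "Pow (Pow {1..n})"]) (auto simp: NC_def partition_on_def)

lemma finite_interval_partitions [simp]: "finite (interval_partitions n)"
  by (rule finite_subset[of _ "Pow (Pow {1..n})"])
    (auto simp: interval_partitions_def partition_on_def)

context
  fixes \<phi> \<phi>' :: "'a::ring_1 \<Rightarrow> complex" and xs :: "'a list" and n :: nat
  assumes n: "n \<ge> 1" and len: "length xs = n"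
begin

private lemma n': "length xs \<ge> 1"
  using n len by simp

lemma free_moment_cumulant:
  "\<phi> (prod_list xs) = (\<Sum>\<pi>\<in>NC n. mult_ext (free_cumulant \<phi>) \<pi> xs)"
  unfolding len[symmetric]
  by (subst sum.remove[OF finite_NC one_block_NC[OF n']])
    (simp add: free_cumulant.simps[of \<phi> xs] del: One_nat_def)

lemma boolean_moment_cumulant:
  "\<phi> (prod_list xs) = (\<Sum>\<pi>\<in>interval_partitions n. mult_ext (boolean_cumulant \<phi>) \<pi> xs)"
  unfolding len[symmetric]
  by (subst sum.remove[OF finite_interval_partitions one_block_interval[OF n']])
    (simp add: boolean_cumulant.simps[of \<phi> xs] del: One_nat_def)

lemma monotone_moment_cumulant:
  "\<phi> (prod_list xs) =
     (\<Sum>\<pi>\<in>NC n. 1 / of_nat (tree_factorial \<pi>) * mult_ext (monotone_cumulant \<phi>) \<pi> xs)"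
  unfolding len[symmetric]
  by (subst sum.remove[OF finite_NC one_block_NC[OF n']])
    (simp add: monotone_cumulant.simps[of \<phi> xs] tree_factorial_one_block[OF n']
      del: One_nat_def)

lemma inf_free_moment_cumulant:
  "\<phi>' (prod_list xs) =
     (\<Sum>\<pi>\<in>NC n. partial_ext (free_cumulant \<phi>) (inf_free_cumulant \<phi> \<phi>') \<pi> xs)"
  unfolding len[symmetric]
  by (subst sum.remove[OF finite_NC one_block_NC[OF n']])
    (simp add: inf_free_cumulant.simps[of \<phi> \<phi>' xs] del: One_nat_def)

lemma inf_boolean_moment_cumulant:
  "\<phi>' (prod_list xs) = (\<Sum>\<pi>\<in>interval_partitions n.
     partial_ext (boolean_cumulant \<phi>) (inf_boolean_cumulant \<phi> \<phi>') \<pi> xs)"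
  unfolding len[symmetric]
  by (subst sum.remove[OF finite_interval_partitions one_block_interval[OF n']])
    (simp add: inf_boolean_cumulant.simps[of \<phi> \<phi>' xs] del: One_nat_def)

lemma inf_monotone_moment_cumulant:
  "\<phi>' (prod_list xs) = (\<Sum>\<pi>\<in>NC n. 1 / of_nat (tree_factorial \<pi>) *
     partial_ext (monotone_cumulant \<phi>) (inf_monotone_cumulant \<phi> \<phi>') \<pi> xs)"
  unfolding len[symmetric]
  by (subst sum.remove[OF finite_NC one_block_NC[OF n']])
    (simp add: inf_monotone_cumulant.simps[of \<phi> \<phi>' xs] tree_factorial_one_block[OF n']
      del: One_nat_def)

end

definition dual_free_cumulant ::
    "('a::ring_1 \<Rightarrow> complex) \<Rightarrow> ('a \<Rightarrow> complex) \<Rightarrow> 'a list \<Rightarrow> dual" where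
  "dual_free_cumulant \<phi> \<phi>' xs = Dual (free_cumulant \<phi> xs) (inf_free_cumulant \<phi> \<phi>' xs)"

definition dual_boolean_cumulant ::
    "('a::ring_1 \<Rightarrow> complex) \<Rightarrow> ('a \<Rightarrow> complex) \<Rightarrow> 'a list \<Rightarrow> dual" where
  "dual_boolean_cumulant \<phi> \<phi>' xs = Dual (boolean_cumulant \<phi> xs) (inf_boolean_cumulant \<phi> \<phi>' xs)"

definition dual_monotone_cumulant ::
    "('a::ring_1 \<Rightarrow> complex) \<Rightarrow> ('a \<Rightarrow> complex) \<Rightarrow> 'a list \<Rightarrow> dual" where
  "dual_monotone_cumulant \<phi> \<phi>' xs =
     Dual (monotone_cumulant \<phi> xs) (inf_monotone_cumulant \<phi> \<phi>' xs)"

end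

(*
  Write M for the G-valued moments of lists (Dual phi phi'), viewed as a function on words.
  Boolean moments satisfy M = 1 + b M for the concatenation product, and this determines b from M.
  Cutting a non-crossing partition after the block of 1 gives M = 1 + I M, where I sums over irreducible
  partitions; the tree factorial is multiplicative under this cut, so b = I for the free and
  for the monotone weights.

  Let T m f insert m into all gaps of subwords weighted by f. Then T is associative, f -> T m f is
  injective when m [] = 1, and, for free weights, I is r with T M inserted between its first and last
  letters. The free moments N of -b satisfy T M N = 1, which inverts the relation b = I(r).

  For the monotone cumulants h give a block W the weight t / N(W). The resulting moments M_t satisfy
  M_t' = T M_t h, because N(V) is the number of all blocks when V contains 1 and n. Hence T M_s M_t = M_(s+t)
  and M_(-1) = N, so that the Boolean cumulants of M_(-1), which are irreducible sums of h with signs,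
  are those of N, which are -r.
*)
theory Submission
  imports Defs "HOL-Analysis.Derivative"
begin

section \<open>Interleaving products on lists\<close>

text \<open>Concatenation (Cauchy) product on words; \<open>conv_sum\<close> is its closed form. The
  recursion peels letters into the first factor, so inductions generalise over
  \<open>p\<close>.\<close>

primrec conv :: "('a list \<Rightarrow> 'b::comm_ring_1) \<Rightarrow> ('a list \<Rightarrow> 'b) \<Rightarrow> 'a list \<Rightarrow> 'b" where
  "conv p q [] = p [] * q []"
| "conv p q (x # xs) = p [] * q (x # xs) + conv (\<lambda>u. p (x # u)) q xs"

text \<open>
  \<open>insertion g m f xs\<close> is the sum over all subwords \<open>z\<close> of \<open>xs\<close> of \<open>f z\<close> times \<open>g\<close> at the gap before
  the first letter of \<open>z\<close> times the product of \<open>m\<close> over the other gaps, the one at the end included.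
\<close>

primrec insertion :: "('a list \<Rightarrow> 'b) \<Rightarrow> ('a list \<Rightarrow> 'b) \<Rightarrow> ('a list \<Rightarrow> 'b) \<Rightarrow> 'a list \<Rightarrow> 'b::comm_ring_1" where
  "insertion g m f [] = g [] * f []"
| "insertion g m f (x # xs) = insertion (\<lambda>u. g (x # u)) m f xs + g [] * insertion m m (\<lambda>z. f (x # z)) xs"

definition unit_fn :: "'a list \<Rightarrow> 'b::comm_ring_1" where
  "unit_fn xs = (if xs = [] then 1 else 0)"

section \<open>Concatenation product and uniqueness of Boolean cumulants\<close>

lemma conv_sum: "conv p q xs = (\<Sum>k\<le>length xs. p (take k xs) * q (drop k xs))"
  by (induction xs arbitrary: p) (simp_all add: sum.atMost_Suc_shift del: sum.atMost_Suc)

lemma conv_cong_right: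
  "(\<And>u. length u \<le> length xs \<Longrightarrow> q u = q' u) \<Longrightarrow> conv p q xs = conv p q' xs"
  by (simp add: conv_sum)

lemma conv_unit_right: "conv p unit_fn xs = p xs"
  by (induction xs arbitrary: p) (simp_all add: unit_fn_def)

text \<open>In the recursion for \<open>m (x # ys)\<close> the term with empty remainder is
  \<open>b (x # ys)\<close> itself, because \<open>m [] = 1\<close>; all other terms use
  \<open>b\<close> on shorter words. Hence moments determine Boolean cumulants.\<close>

lemma boolean_unique:
  assumes m: "m [] = 1"
    and b: "\<And>x xs. m (x # xs) = conv (\<lambda>u. b (x # u)) m xs"
    and b': "\<And>x xs. m (x # xs) = conv (\<lambda>u. b' (x # u)) m xs"
  shows "xs \<noteq> [] \<Longrightarrow> b xs = b' xs"
proof (induction "length xs" arbitrary: xs rule: less_induct)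
  case less
  then obtain x ys where xs: "xs = x # ys" by (cases xs) auto
  have split: "conv (\<lambda>u. c (x # u)) m ys =
      (\<Sum>k<length ys. c (x # take k ys) * m (drop k ys)) + c (x # ys)" for c
    by (simp add: conv_sum lessThan_Suc_atMost[symmetric] m)
  have "(\<Sum>k<length ys. b (x # take k ys) * m (drop k ys)) =
      (\<Sum>k<length ys. b' (x # take k ys) * m (drop k ys))"
    using less xs by (intro sum.cong) auto
  then show ?case
    using b[of x ys] b'[of x ys] by (simp add: split xs)
qed

section \<open>Linearity, associativity and invertibility of insertion\<close>

lemma insertion_cong:
  "(\<And>u. length u \<le> length xs \<Longrightarrow> g u = g' u) \<Longrightarrow> (\<And>u. length u \<le> length xs \<Longrightarrow> m u = m' u) \<Longrightarrow>
    insertion g m f xs = insertion g' m' f xs"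
proof (induction xs arbitrary: g g' f)
  case (Cons x xs)
  have "insertion (\<lambda>u. g (x # u)) m f xs = insertion (\<lambda>u. g' (x # u)) m' f xs"
    by (rule Cons.IH) (use Cons.prems in auto)
  moreover have "insertion m m (\<lambda>z. f (x # z)) xs = insertion m' m' (\<lambda>z. f (x # z)) xs"
    by (rule Cons.IH) (use Cons.prems in auto)
  ultimately show ?case using Cons.prems(1)[of "[]"] by simp
qed simp

text \<open>With \<open>f [] = 0\<close> every contributing subword keeps a letter of
  \<open>xs\<close>, so no gap is as long as \<open>xs\<close>. This strictness drives the induction
  in \<open>nc_sum_flow\<close>.\<close>

lemma insertion_cong_shorter:
  "f [] = 0 \<Longrightarrow> (\<And>u. length u < length xs \<Longrightarrow> g u = g' u) \<Longrightarrow>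
    (\<And>u. length u < length xs \<Longrightarrow> m u = m' u) \<Longrightarrow> insertion g m f xs = insertion g' m' f xs"
proof (induction xs arbitrary: g g')
  case (Cons x xs)
  have "insertion (\<lambda>u. g (x # u)) m f xs = insertion (\<lambda>u. g' (x # u)) m' f xs"
    by (rule Cons.IH) (use Cons.prems in auto)
  moreover have "insertion m m (\<lambda>z. f (x # z)) xs = insertion m' m' (\<lambda>z. f (x # z)) xs"
    by (rule insertion_cong) (use Cons.prems in auto)
  ultimately show ?case using Cons.prems(2)[of "[]"] by simp
qed simp

lemma insertion_add_left: "insertion (\<lambda>u. g u + g' u) m f xs = insertion g m f xs + insertion g' m f xs"
  by (induction xs arbitrary: g g') (simp_all add: algebra_simps)

lemma insertion_mult_left: "insertion (\<lambda>u. c * g u) m f xs = c * insertion g m f xs"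
  by (induction xs arbitrary: g) (simp_all add: algebra_simps)

lemma insertion_add_right: "insertion g m (\<lambda>u. f u + f' u) xs = insertion g m f xs + insertion g m f' xs"
  by (induction xs arbitrary: g f f') (simp_all add: algebra_simps)

lemma insertion_mult_right: "insertion g m (\<lambda>u. c * f u) xs = c * insertion g m f xs"
  by (induction xs arbitrary: g f) (simp_all add: algebra_simps)

lemma insertion_uminus_right: "insertion g m (\<lambda>u. - f u) xs = - insertion g m f xs"
  using insertion_mult_right[of g m "-1" f xs] by simp

lemma insertion_diff_right: "insertion g m (\<lambda>u. f u - f' u) xs = insertion g m f xs - insertion g m f' xs"
  using insertion_add_right[of g m f "\<lambda>u. - f' u" xs] by (simp add: insertion_uminus_right)

text \<open>Both sides sum over pairs of nested subwords, z inside y inside \<open>xs\<close>. The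
  left side chooses y first; the right side chooses z first and then the part of y in each gap of
  z.\<close>

lemma insertion_assoc: "insertion g m (insertion k n f) xs = insertion (insertion g m k) (insertion m m n) f xs"
  by (induction xs arbitrary: g k f)
    (simp_all add: insertion_add_left insertion_mult_left insertion_add_right insertion_mult_right algebra_simps)

lemma insertion_zero_left: "insertion (\<lambda>u. 0) m f xs = 0"
  by (induction xs) simp_all

lemma insertion_zero_right: "insertion g m (\<lambda>u. 0) xs = 0"
  by (induction xs arbitrary: g) simp_all

lemma insertion_unit_left: "insertion unit_fn unit_fn f xs = f xs"
  by (induction xs arbitrary: f) (simp_all add: unit_fn_def insertion_zero_left)

lemma insertion_unit_right: "insertion g m unit_fn xs = g xs"
  by (induction xs arbitrary: g) (simp_all add: unit_fn_def insertion_zero_right)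

text \<open>The factor \<open>p\<close> reads only a prefix of the first gap, so that prefix can be
  split off before anything is inserted.\<close>

lemma insertion_conv: "insertion (conv p g) m f xs = conv p (insertion g m f) xs"
  by (induction xs arbitrary: p)
    (simp_all add: insertion_add_left insertion_mult_left algebra_simps)

text \<open>Only the subword \<open>xs\<close> itself survives; its gaps are all empty, and those
  after the first contribute \<open>m [] = 1\<close>.\<close>

lemma insertion_leading:
  "m [] = 1 \<Longrightarrow> (\<And>u. length u < length xs \<Longrightarrow> f u = 0) \<Longrightarrow> insertion g m f xs = g [] * f xs"
proof (induction xs arbitrary: g f)
  case (Cons x xs)
  have "insertion (\<lambda>u. g (x # u)) m f xs = g [x] * f xs"
    by (rule Cons.IH) (use Cons.prems in auto)
  moreover have "insertion m m (\<lambda>z. f (x # z)) xs = m [] * f (x # xs)"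
    by (rule Cons.IH) (use Cons.prems in auto)
  ultimately show ?case using Cons.prems by simp
qed simp

text \<open>Insertion is unitriangular in word length: once the difference vanishes on shorter
  words, \<open>insertion_leading\<close> reads off its value at \<open>xs\<close>.\<close>

lemma insertion_inject:
  assumes m: "m [] = 1" and eq: "\<And>xs. insertion m m f xs = insertion m m f' xs"
  shows "f xs = f' xs"
proof (induction "length xs" arbitrary: xs rule: less_induct)
  case less
  have "insertion m m (\<lambda>u. f u - f' u) xs = m [] * (f xs - f' xs)"
    using less by (intro insertion_leading) (auto simp: m)
  then show ?case by (simp add: insertion_diff_right eq m)
qed

text \<open>Sorts the subwords by their last letter \<open>xs ! k\<close>; the empty one gives the
  first term. The defining recursion peels from the left, whereas the block of 1 will lose its
  letters from the right.\<close>

lemma insertion_right: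
  "insertion g m f xs = f [] * g xs +
     (\<Sum>k<length xs. insertion g m (\<lambda>z. f (z @ [xs ! k])) (take k xs) * m (drop (Suc k) xs))"
  by (induction xs arbitrary: g f)
    (simp_all add: sum.lessThan_Suc_shift sum.distrib sum_distrib_left algebra_simps
      del: sum.lessThan_Suc)

text \<open>The first letter lies in the first gap or in the chosen subword. The recursion of
  \<open>m\<close> turns the first case into a term with \<open>b\<close>, the recursion of
  \<open>n\<close> turns the second into one with \<open>- b\<close>; by induction the two terms
  cancel.\<close>

lemma insertion_inverse:
  assumes m: "m [] = 1" "\<And>x xs. m (x # xs) = conv (\<lambda>u. b (x # u)) m xs"
    and n: "n [] = 1" "\<And>x xs. n (x # xs) = insertion n n (\<lambda>u. - b (x # u)) xs"
  shows "insertion m m n xs = unit_fn xs"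
proof (induction "length xs" arbitrary: xs rule: less_induct)
  case less
  show ?case
  proof (cases xs)
    case (Cons x ys)
    let ?E = "insertion m m n"
    have E: "?E u = unit_fn u" if "length u \<le> length ys" for u
      using less[of u] that Cons by auto
    have "?E xs = conv (\<lambda>u. b (x # u)) ?E ys + insertion m m (insertion n n (\<lambda>u. - b (x # u))) ys"
      using insertion_conv[of "\<lambda>u. b (x # u)" m m n ys] by (simp add: Cons m n)
    also have "conv (\<lambda>u. b (x # u)) ?E ys = b (x # ys)"
      using conv_cong_right[of ys ?E unit_fn, OF E] by (simp add: conv_unit_right)
    also have "insertion m m (insertion n n (\<lambda>u. - b (x # u))) ys = insertion ?E ?E (\<lambda>u. - b (x # u)) ys"
      by (rule insertion_assoc)
    also have "\<dots> = - b (x # ys)"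
      using insertion_cong[of ys ?E unit_fn ?E unit_fn, OF E E] by (simp add: insertion_unit_left)
    finally show ?thesis by (simp add: Cons unit_fn_def)
  qed (simp add: unit_fn_def m n)
qed

section \<open>Non-crossing partitions\<close>

definition noncrossing :: "nat set set \<Rightarrow> bool" where
  "noncrossing \<pi> \<longleftrightarrow> (\<forall>V\<in>\<pi>. \<forall>W\<in>\<pi>. \<forall>i\<in>V. \<forall>j\<in>W. \<forall>k\<in>V. \<forall>l\<in>W. i < j \<longrightarrow> j < k \<longrightarrow> k < l \<longrightarrow> V = W)"

text \<open>General ground sets are needed because the blocks to the right of a cut live on
  \<open>{Suc p..n}\<close>.\<close>

definition NC_on :: "nat set \<Rightarrow> nat set set set" where
  "NC_on A = {\<pi>. partition_on A \<pi> \<and> noncrossing \<pi>}"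

lemma NC_eq_NC_on: "NC n = NC_on {1..n}"
proof -
  have "noncrossing \<pi> \<longleftrightarrow> \<not> (\<exists>V\<in>\<pi>. \<exists>W\<in>\<pi>. V \<noteq> W \<and>
      (\<exists>i j k l. i < j \<and> j < k \<and> k < l \<and> i \<in> V \<and> k \<in> V \<and> j \<in> W \<and> l \<in> W))" for \<pi>
    unfolding noncrossing_def by (simp, meson)
  then show ?thesis unfolding NC_def NC_on_def by simp
qed

definition nested :: "nat set set \<Rightarrow> nat set \<Rightarrow> nat" where
  "nested \<pi> W = card {U\<in>\<pi>. U \<subseteq> {Min W..Max W}}"

text \<open>One product serves the free, Boolean and monotone cases: a factor may depend on the
  block and on \<open>nested \<pi> W\<close>, the N(W) of the tree factorial.\<close>

definition weight :: "(nat set \<Rightarrow> nat \<Rightarrow> 'b::comm_ring_1) \<Rightarrow> nat set set \<Rightarrow> 'b" where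
  "weight F \<pi> = (\<Prod>W\<in>\<pi>. F W (nested \<pi> W))"

section \<open>Blocks, unions and weights\<close>

lemma finite_NC_on: "finite A \<Longrightarrow> finite (NC_on A)"
  by (rule finite_subset[of _ "Pow (Pow A)"]) (auto simp: NC_on_def partition_on_def)

lemma NC_on_block:
  assumes "\<pi> \<in> NC_on A" "V \<in> \<pi>"
  shows "V \<subseteq> A" "V \<noteq> {}"
  using assms by (auto simp: NC_on_def partition_on_def)

lemma NC_on_same_block:
  assumes "\<pi> \<in> NC_on A" "V \<in> \<pi>" "W \<in> \<pi>" "i \<in> V" "i \<in> W"
  shows "V = W"
  using assms by (auto simp: NC_on_def partition_on_def disjoint_def)

lemma NC_on_finite:
  assumes "\<pi> \<in> NC_on A" "finite A"
  shows "finite \<pi>" and "V \<in> \<pi> \<Longrightarrow> finite V"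
  using assms finite_elements[of A \<pi>] by (auto simp: NC_on_def partition_on_def intro: finite_subset)

lemma NC_on_crossing:
  assumes "\<pi> \<in> NC_on A" "V \<in> \<pi>" "W \<in> \<pi>" "i \<in> V" "j \<in> W" "k \<in> V" "l \<in> W" "i < j" "j < k" "k < l"
  shows "V = W"
proof -
  have *: "noncrossing \<pi>" using assms(1) by (simp add: NC_on_def)
  show ?thesis
    by (rule *[unfolded noncrossing_def, rule_format]) (fact assms)+
qed

lemma NC_on_Un:
  assumes "\<pi> \<in> NC_on A" "\<sigma> \<in> NC_on B" and less: "\<And>i j. i \<in> A \<Longrightarrow> j \<in> B \<Longrightarrow> i < j"
  shows "\<pi> \<union> \<sigma> \<in> NC_on (A \<union> B)"
proof -
  have "A \<inter> B = {}" using less by fastforce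
  then have "partition_on (A \<union> B) (\<pi> \<union> \<sigma>)"
    using assms(1,2) by (auto simp: NC_on_def partition_on_def intro!: disjoint_union)
  moreover have "noncrossing (\<pi> \<union> \<sigma>)"
    unfolding noncrossing_def
  proof (intro ballI impI)
    fix V W i j k l
    assume *: "V \<in> \<pi> \<union> \<sigma>" "W \<in> \<pi> \<union> \<sigma>" "i \<in> V" "j \<in> W" "k \<in> V" "l \<in> W" "i < j" "j < k" "k < l"
    have A: "U \<subseteq> A" if "U \<in> \<pi>" for U using NC_on_block[OF assms(1) that] by simp
    have B: "U \<subseteq> B" if "U \<in> \<sigma>" for U using NC_on_block[OF assms(2) that] by simp
    consider "V \<in> \<pi>" "W \<in> \<pi>" | "V \<in> \<sigma>" "W \<in> \<sigma>" | "V \<in> \<pi>" "W \<in> \<sigma>" | "V \<in> \<sigma>" "W \<in> \<pi>"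
      using * by blast
    then show "V = W"
    proof cases
      case 1 then show ?thesis using NC_on_crossing[OF assms(1)] * by blast
    next
      case 2 then show ?thesis using NC_on_crossing[OF assms(2)] * by blast
    next
      case 3 then have "k < j" using * A B less by blast
      then show ?thesis using * by simp
    next
      case 4 then have "l < k" using * A B less by blast
      then show ?thesis using * by simp
    qed
  qed
  ultimately show ?thesis by (simp add: NC_on_def)
qed

lemma NC_on_subset:
  assumes "\<pi> \<in> NC_on A" "\<sigma> \<subseteq> \<pi>"
  shows "\<sigma> \<in> NC_on (\<Union>\<sigma>)"
proof -
  have "disjoint \<sigma>" "{} \<notin> \<sigma>"
    using assms by (auto simp: NC_on_def partition_on_def intro: pairwise_subset)
  moreover have "noncrossing \<sigma>"
    using assms unfolding NC_on_def noncrossing_def by (simp add: subset_iff)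
  ultimately show ?thesis by (simp add: NC_on_def partition_on_def)
qed

lemma nested_subset:
  assumes "\<And>U. U \<in> \<pi> \<Longrightarrow> U \<subseteq> {Min W..Max W} \<Longrightarrow> U \<in> \<sigma>" "\<sigma> \<subseteq> \<pi>"
  shows "nested \<pi> W = nested \<sigma> W"
  unfolding nested_def using assms by (intro arg_cong[of _ _ card]) blast

text \<open>The hull \<open>{Min W..Max W}\<close> of a block stays on its side of the cut after
  \<open>p\<close>, so nested counts do not mix. This is the multiplicativity of the tree
  factorial.\<close>

lemma weight_Un:
  assumes "\<pi> \<in> NC_on {1..p}" "\<sigma> \<in> NC_on {Suc p..n}"
  shows "weight F (\<pi> \<union> \<sigma>) = weight F \<pi> * weight F \<sigma>"
proof -
  note \<pi> = NC_on_block[OF assms(1)] NC_on_finite[OF assms(1)]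
  note \<sigma> = NC_on_block[OF assms(2)] NC_on_finite[OF assms(2)]
  have disj: "\<pi> \<inter> \<sigma> = {}"
    using \<pi>(1,2) \<sigma>(1) by fastforce
  have 1: "nested (\<pi> \<union> \<sigma>) W = nested \<pi> W" if W: "W \<in> \<pi>" for W
  proof (rule nested_subset)
    fix U assume U: "U \<in> \<pi> \<union> \<sigma>" "U \<subseteq> {Min W..Max W}"
    have "Max W \<in> W" using \<pi> W by auto
    then have "Max W \<le> p" using \<pi>(1)[OF W] by auto
    with U \<sigma>(1,2)[of U] show "U \<in> \<pi>" by fastforce
  qed simp
  have 2: "nested (\<pi> \<union> \<sigma>) W = nested \<sigma> W" if W: "W \<in> \<sigma>" for W
  proof (rule nested_subset)
    fix U assume U: "U \<in> \<pi> \<union> \<sigma>" "U \<subseteq> {Min W..Max W}"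
    have "Min W \<in> W" using \<sigma> W by auto
    then have "Min W > p" using \<sigma>(1)[OF W] by auto
    with U \<pi>(1,2)[of U] show "U \<in> \<sigma>" by fastforce
  qed simp
  show ?thesis
    unfolding weight_def using disj \<pi>(3) \<sigma>(3)
    by (simp add: prod.union_disjoint 1 2)
qed

lemma NC_irrD:
  assumes "\<pi> \<in> NC_irr p"
  obtains V where "V \<in> \<pi>" "1 \<in> V" "p \<in> V" "\<pi> \<in> NC_on {1..p}"
  using assms unfolding NC_irr_def NC_eq_NC_on by blast

section \<open>Cutting a partition after the block of 1\<close>

text \<open>A set instead of a chosen block: by \<open>first_blocks_eq\<close> it is a singleton,
  and its union recovers the block of 1.\<close>

definition first_blocks :: "nat set set \<Rightarrow> nat set set" where
  "first_blocks \<pi> = {V\<in>\<pi>. 1 \<in> V}"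

lemma first_blocks_eq:
  assumes "\<pi> \<in> NC_on A" "V \<in> \<pi>" "1 \<in> V"
  shows "first_blocks \<pi> = {V}"
  using NC_on_same_block[OF assms(1)] assms unfolding first_blocks_def by blast

text \<open>The cut point \<open>p\<close> is the maximum of the block of 1. A block reaching beyond
  \<open>p\<close> cannot also have points below it, since 1 and \<open>p\<close> are
  joined.\<close>

lemma sum_NC_split:
  assumes n: "n \<ge> 1"
  shows "(\<Sum>\<pi>\<in>NC n. G \<pi>) = (\<Sum>p=1..n. \<Sum>\<pi>\<in>NC_irr p. \<Sum>\<sigma>\<in>NC_on {Suc p..n}. G (\<pi> \<union> \<sigma>))"
proof -
  define S where "S = (SIGMA p:{1..n}. NC_irr p \<times> NC_on {Suc p..n})"
  define j where "j = (\<lambda>(p::nat, \<pi>::nat set set, \<sigma>). \<pi> \<union> \<sigma>)"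
  define i where "i = (\<lambda>\<rho>. let p = Max (\<Union>(first_blocks \<rho>)) in
    (p, {V\<in>\<rho>. V \<subseteq> {1..p}}, {V\<in>\<rho>. \<not> V \<subseteq> {1..p}}))"
  have fin: "finite (NC_irr p)" for p
    by (rule finite_subset[OF _ finite_NC[of p]]) (auto simp: NC_irr_def)
  have "(\<Sum>x\<in>S. G (j x)) = (\<Sum>\<pi>\<in>NC n. G \<pi>)"
  proof (rule sum.reindex_bij_witness[where i = i and j = j])
    fix x assume "x \<in> S"
    then obtain p \<pi> \<sigma> where x: "x = (p, \<pi>, \<sigma>)" "1 \<le> p" "p \<le> n" "\<pi> \<in> NC_irr p" "\<sigma> \<in> NC_on {Suc p..n}"
      by (auto simp: S_def)
    obtain B where B: "B \<in> \<pi>" "1 \<in> B" "p \<in> B" and \<pi>: "\<pi> \<in> NC_on {1..p}"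
      using NC_irrD[OF x(4)] by metis
    have "\<pi> \<union> \<sigma> \<in> NC_on ({1..p} \<union> {Suc p..n})"
      using \<pi> x(5) by (rule NC_on_Un) auto
    moreover have "{1..p} \<union> {Suc p..n} = {1..n}" using x by auto
    ultimately have U: "\<pi> \<union> \<sigma> \<in> NC_on {1..n}" by simp
    then show "j x \<in> NC n" by (simp add: j_def x NC_eq_NC_on)
    have "Max B = p"
      using NC_on_block(1)[OF \<pi> B(1)] B NC_on_finite(2)[OF \<pi> _ B(1)]
      by (intro Max_eqI) auto
    then have M: "Max (\<Union>(first_blocks (\<pi> \<union> \<sigma>))) = p"
      using first_blocks_eq[OF U, of B] B by simp
    have "V \<subseteq> {1..p} \<longleftrightarrow> V \<in> \<pi>" "\<not> V \<subseteq> {1..p} \<longleftrightarrow> V \<in> \<sigma>" if "V \<in> \<pi> \<union> \<sigma>" for V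
      using that NC_on_block[OF \<pi>, of V] NC_on_block[OF x(5), of V] by fastforce+
    then show "i (j x) = x"
      by (auto simp: i_def j_def x M Let_def)
  next
    fix \<rho> assume "\<rho> \<in> NC n"
    then have \<rho>: "\<rho> \<in> NC_on {1..n}" by (simp add: NC_eq_NC_on)
    then have "\<Union>\<rho> = {1..n}" by (simp add: NC_on_def partition_on_def)
    then have "1 \<in> \<Union>\<rho>" using n by simp
    then obtain B where B: "B \<in> \<rho>" "1 \<in> B" by blast
    define p where "p = Max B"
    have p: "Max (\<Union>(first_blocks \<rho>)) = p"
      using first_blocks_eq[OF \<rho> B] by (simp add: p_def)
    have finB: "finite B" using NC_on_finite(2)[OF \<rho> _ B(1)] by simp
    have pB: "p \<in> B" unfolding p_def using B finB by (intro Max_in) auto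
    have pn: "1 \<le> p" "p \<le> n" using NC_on_block(1)[OF \<rho> B(1)] pB by auto
    show "j (i \<rho>) = \<rho>" by (auto simp: i_def j_def Let_def)
    \<comment> \<open>Given \<open>l > p\<close> in V, a point \<open>i < p\<close> of V would yield
      1 < i < p < l, a crossing of B and V.\<close>
    have right: "V \<subseteq> {Suc p..n}" if V: "V \<in> \<rho>" "\<not> V \<subseteq> {1..p}" for V
    proof
      fix i assume i: "i \<in> V"
      have Vn: "V \<subseteq> {1..n}" using NC_on_block(1)[OF \<rho> V(1)] .
      obtain l where l: "l \<in> V" "l > p" using V(2) Vn by fastforce
      have "V \<noteq> B" using l Max_ge[OF finB, of l] by (auto simp: p_def)
      then have "i \<notin> B" using NC_on_same_block[OF \<rho> V(1) B(1)] i by blast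
      then have "i \<noteq> 1" "i \<noteq> p" using B pB by blast+
      have "\<not> i < p"
      proof
        assume "i < p"
        moreover have "1 < i" using \<open>i \<noteq> 1\<close> i Vn by force
        ultimately have "B = V"
          using NC_on_crossing[OF \<rho> B(1) V(1) B(2) i pB l(1)] l by simp
        then show False using \<open>V \<noteq> B\<close> by simp
      qed
      then show "i \<in> {Suc p..n}" using \<open>i \<noteq> p\<close> i Vn by auto
    qed
    let ?\<pi> = "{V\<in>\<rho>. V \<subseteq> {1..p}}" and ?\<sigma> = "{V\<in>\<rho>. \<not> V \<subseteq> {1..p}}"
    have U: "\<Union>?\<pi> \<union> \<Union>?\<sigma> = \<Union>\<rho>" by blast
    \<comment> \<open>Turns two inclusions into equalities when the total unions agree and the
      larger sets are disjoint.\<close>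
    have *: "A = C \<and> B = D" if "A \<union> B = C \<union> D" "A \<subseteq> C" "B \<subseteq> D" "C \<inter> D = {}" for A B C D :: "nat set"
      using that by blast
    have "\<Union>?\<pi> = {1..p} \<and> \<Union>?\<sigma> = {Suc p..n}"
    proof (rule *)
      show "\<Union>?\<pi> \<union> \<Union>?\<sigma> = {1..p} \<union> {Suc p..n}"
        unfolding U \<open>\<Union>\<rho> = {1..n}\<close> using pn by auto
      show "\<Union>?\<sigma> \<subseteq> {Suc p..n}" using right by blast
    qed auto
    then have "?\<pi> \<in> NC_on {1..p}" "?\<sigma> \<in> NC_on {Suc p..n}"
      using NC_on_subset[OF \<rho>, of ?\<pi>] NC_on_subset[OF \<rho>, of ?\<sigma>] by auto
    moreover have "B \<in> ?\<pi>"
      using B NC_on_block(1)[OF \<rho> B(1)] finB by (auto simp: p_def)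
    ultimately have "?\<pi> \<in> NC_irr p" "?\<sigma> \<in> NC_on {Suc p..n}"
      using B(2) pB unfolding NC_irr_def NC_eq_NC_on by auto
    then show "i \<rho> \<in> S"
      using pn by (simp add: i_def S_def Let_def p)
  qed simp
  moreover have "(\<Sum>x\<in>S. G (j x)) =
      (\<Sum>p=1..n. \<Sum>\<pi>\<in>NC_irr p. \<Sum>\<sigma>\<in>NC_on {Suc p..n}. G (\<pi> \<union> \<sigma>))"
    unfolding S_def
    by (simp add: sum.Sigma sum.cartesian_product fin finite_NC_on j_def split_def)
  ultimately show ?thesis by simp
qed

section \<open>Renumbering the ground set\<close>

lemma NC_on_image_iff:
  assumes "strict_mono s"
  shows "(`) s ` \<pi> \<in> NC_on (s ` A) \<longleftrightarrow> \<pi> \<in> NC_on A"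
proof -
  have inj: "inj s" using assms by (rule strict_mono_imp_inj_on)
  have "\<Union>((`) s ` \<pi>) = s ` A \<longleftrightarrow> \<Union>\<pi> = A"
    using inj_image_eq_iff[OF inj, of "\<Union>\<pi>" A] by (simp add: image_Union)
  moreover have "disjoint ((`) s ` \<pi>) \<longleftrightarrow> disjoint \<pi>"
    by (simp add: disjoint_def inj_image_eq_iff[OF inj] image_Int[OF inj, symmetric])
  moreover have "noncrossing ((`) s ` \<pi>) \<longleftrightarrow> noncrossing \<pi>"
    by (simp add: noncrossing_def inj_image_eq_iff[OF inj] strict_mono_less[OF assms])
  moreover have "{} \<notin> (`) s ` \<pi> \<longleftrightarrow> {} \<notin> \<pi>"
    by auto
  ultimately show ?thesis
    unfolding NC_on_def partition_on_def by blast
qed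

lemma NC_on_image:
  assumes "strict_mono s"
  shows "NC_on (s ` A) = (`) ((`) s) ` NC_on A"
proof
  show "NC_on (s ` A) \<subseteq> (`) ((`) s) ` NC_on A"
  proof
    fix \<sigma> assume \<sigma>: "\<sigma> \<in> NC_on (s ` A)"
    have "\<sigma> \<subseteq> (`) s ` Pow A"
      using NC_on_block(1)[OF \<sigma>] by (auto simp: image_Pow_surj)
    then obtain \<pi> where "\<sigma> = (`) s ` \<pi>" by (auto simp: subset_image_iff)
    then show "\<sigma> \<in> (`) ((`) s) ` NC_on A" using \<sigma> NC_on_image_iff[OF assms] by blast
  qed
  show "(`) ((`) s) ` NC_on A \<subseteq> NC_on (s ` A)"
    using NC_on_image_iff[OF assms] by blast
qed

lemma nested_shift:
  assumes \<pi>: "\<pi> \<in> NC_on A" "finite A" and W: "W \<in> \<pi>"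
  shows "nested ((`) ((+) p) ` \<pi>) ((+) p ` W) = nested \<pi> W"
proof -
  let ?s = "(+) p :: nat \<Rightarrow> nat"
  have inj: "inj_on ((`) ?s) X" for X by (auto intro!: inj_onI simp: inj_image_eq_iff)
  have W': "finite W" "W \<noteq> {}" using NC_on_block[OF \<pi>(1) W] NC_on_finite[OF \<pi> ] W by auto
  then have m: "Min (?s ` W) = p + Min W" "Max (?s ` W) = p + Max W"
    by (auto simp: mono_Min_commute[symmetric] mono_Max_commute[symmetric] mono_def)
  have "?s ` U \<subseteq> {Min (?s ` W)..Max (?s ` W)} \<longleftrightarrow> U \<subseteq> {Min W..Max W}" for U
    unfolding m by auto
  then have "{U \<in> (`) ?s ` \<pi>. U \<subseteq> {Min (?s ` W)..Max (?s ` W)}} = (`) ?s ` {U\<in>\<pi>. U \<subseteq> {Min W..Max W}}"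
    by blast
  then show ?thesis unfolding nested_def by (simp add: card_image[OF inj])
qed

lemma sum_NC_on_shift:
  assumes "p \<le> n"
  shows "(\<Sum>\<sigma>\<in>NC_on {Suc p..n}. weight F \<sigma>) = (\<Sum>\<pi>\<in>NC (n - p). weight (\<lambda>W. F ((+) p ` W)) \<pi>)"
proof -
  let ?s = "(+) p :: nat \<Rightarrow> nat"
  have inj: "inj_on ((`) ?s) X" for X by (auto intro!: inj_onI simp: inj_image_eq_iff)
  have inj2: "inj_on ((`) ((`) ?s)) X" for X
    by (intro inj_onI) (simp add: inj_image_eq_iff[OF inj])
  have "?s ` {1..n - p} = {Suc p..n}"
    using assms unfolding image_add_atLeastAtMost by simp
  then have "NC_on {Suc p..n} = (`) ((`) ?s) ` NC (n - p)"
    using NC_on_image[of ?s "{1..n - p}"] by (simp only: NC_eq_NC_on strict_mono_def) simp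
  moreover have "weight F ((`) ?s ` \<pi>) = weight (\<lambda>W. F (?s ` W)) \<pi>" if "\<pi> \<in> NC (n - p)" for \<pi>
    using that nested_shift[of \<pi> "{1..n - p}"]
    by (simp add: weight_def prod.reindex[OF inj] NC_eq_NC_on)
  ultimately show ?thesis by (simp add: sum.reindex[OF inj2])
qed

lemma sum_weight_NC:
  assumes "n \<ge> 1"
  shows "(\<Sum>\<pi>\<in>NC n. weight F \<pi>) =
    (\<Sum>p=1..n. (\<Sum>\<pi>\<in>NC_irr p. weight F \<pi>) * (\<Sum>\<pi>\<in>NC (n - p). weight (\<lambda>W. F ((+) p ` W)) \<pi>))"
proof -
  have "(\<Sum>\<pi>\<in>NC_irr p. \<Sum>\<sigma>\<in>NC_on {Suc p..n}. weight F (\<pi> \<union> \<sigma>)) =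
     (\<Sum>\<pi>\<in>NC_irr p. weight F \<pi>) * (\<Sum>\<pi>\<in>NC (n - p). weight (\<lambda>W. F ((+) p ` W)) \<pi>)"
    if p: "p \<in> {1..n}" for p
  proof -
    have "weight F (\<pi> \<union> \<sigma>) = weight F \<pi> * weight F \<sigma>"
      if "\<pi> \<in> NC_irr p" "\<sigma> \<in> NC_on {Suc p..n}" for \<pi> \<sigma>
      using that weight_Un[of \<pi> p \<sigma> n F] by (simp add: NC_irr_def NC_eq_NC_on)
    then show ?thesis
      using p by (simp add: sum_product sum_NC_on_shift[symmetric])
  qed
  then show ?thesis using assms by (simp add: sum_NC_split)
qed

text \<open>
  Irreducible partitions of \<open>{1..n + 1}\<close> correspond to all non-crossing partitions of \<open>{1..n}\<close> by
  adding \<open>n + 1\<close> to the block of 1.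
\<close>

definition extend_block :: "nat \<Rightarrow> nat set \<Rightarrow> nat set" where
  "extend_block n W = (if 1 \<in> W then insert (Suc n) W else W)"

definition extend_root :: "nat \<Rightarrow> nat set set \<Rightarrow> nat set set" where
  "extend_root n \<pi> = extend_block n ` \<pi>"

definition restrict_last :: "nat \<Rightarrow> nat set set \<Rightarrow> nat set set" where
  "restrict_last n \<pi> = (\<lambda>W. W - {Suc n}) ` \<pi>"

lemma NC_first_block:
  assumes "\<pi> \<in> NC n" "n \<ge> 1"
  obtains B where "B \<in> \<pi>" "1 \<in> B"
proof -
  have "1 \<in> \<Union>\<pi>" using assms by (simp add: NC_def partition_on_def)
  then show ?thesis using that by blast
qed

text \<open>A new crossing would have to use \<open>Suc n\<close>, which as the largest point can
  only be the last of the four.\<close>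

lemma extend_root_NC_irr:
  assumes \<pi>: "\<pi> \<in> NC n" and n: "n \<ge> 1"
  shows "extend_root n \<pi> \<in> NC_irr (Suc n)"
proof -
  have \<pi>': "\<pi> \<in> NC_on {1..n}" using \<pi> by (simp add: NC_eq_NC_on)
  obtain B where B: "B \<in> \<pi>" "1 \<in> B" using NC_first_block[OF assms] .
  have sub: "V \<subseteq> {1..n}" "V \<noteq> {}" "Suc n \<notin> V" if "V \<in> \<pi>" for V
    using NC_on_block[OF \<pi>' that] by auto
  have same: "V = B" if "V \<in> \<pi>" "1 \<in> V" for V
    using NC_on_same_block[OF \<pi>' that(1) B(1) that(2) B(2)] .
  have disj: "V = W" if "V \<in> \<pi>" "W \<in> \<pi>" "i \<in> V" "i \<in> W" for V W i
    using NC_on_same_block[OF \<pi>'] that by blast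
  define e where "e = extend_block n"
  have e: "i \<in> e W \<longleftrightarrow> i \<in> W \<or> i = Suc n \<and> W = B" if "W \<in> \<pi>" for i W
  proof -
    have "1 \<in> W \<longleftrightarrow> W = B" using same[OF that] B(2) by blast
    then show ?thesis by (auto simp: e_def extend_block_def)
  qed
  have un: "\<Union>\<pi> = {1..n}" using \<pi> by (simp add: NC_def partition_on_def)
  have "\<Union>(e ` \<pi>) = insert (Suc n) (\<Union>\<pi>)"
    using B by (auto simp: e)
  then have "\<Union>(e ` \<pi>) = {1..Suc n}" unfolding un by auto
  moreover have "disjoint (e ` \<pi>)"
  proof (intro disjointI)
    fix V' W' assume "V' \<in> e ` \<pi>" "W' \<in> e ` \<pi>" and ne: "V' \<noteq> W'"
    then obtain V W where VW: "V \<in> \<pi>" "W \<in> \<pi>" "V' = e V" "W' = e W" by blast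
    with ne have "V \<noteq> W" by blast
    have "i \<notin> e W" if "i \<in> e V" for i
      using that \<open>V \<noteq> W\<close> disj[OF VW(1,2), of i] sub(3)[OF VW(1)] sub(3)[OF VW(2)]
      unfolding e[OF VW(1)] e[OF VW(2)] by auto
    then show "V' \<inter> W' = {}" using VW by blast
  qed
  moreover have "{} \<notin> e ` \<pi>" using sub by (auto simp: e_def extend_block_def)
  moreover have "noncrossing (e ` \<pi>)"
    unfolding noncrossing_def
  proof clarify
    fix V W i j k l
    assume *: "V \<in> \<pi>" "W \<in> \<pi>" "i \<in> e V" "j \<in> e W" "k \<in> e V" "l \<in> e W" "i < j" "j < k" "k < l"
    have l: "l \<le> Suc n" using * sub[of W] by (auto simp: e)
    then have ijk: "i \<in> V" "j \<in> W" "k \<in> V" using * by (auto simp: e)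
    have "V = W"
    proof (cases "l \<in> W")
      case True
      then show ?thesis using NC_on_crossing[OF \<pi>' *(1,2)] ijk * by blast
    next
      case False
      then have "W = B" using * e by blast
      \<comment> \<open>Here \<open>W = B\<close> also contains 1, so 1 < i < j < k is a crossing of
        B and V already present in \<open>\<pi>\<close>, unless \<open>i = 1\<close> puts 1 into
        V.\<close>
      show ?thesis
      proof (cases "i = 1")
        case True
        then show ?thesis using ijk same * \<open>W = B\<close> by blast
      next
        case False
        then have "1 < i" using ijk * sub[of V] by force
        then show ?thesis
          using NC_on_crossing[OF \<pi>' *(2,1), of 1 i j k] ijk * B \<open>W = B\<close> by blast
      qed
    qed
    then show "e V = e W" by simp
  qed
  ultimately have "extend_root n \<pi> \<in> NC (Suc n)"
    by (simp add: NC_eq_NC_on NC_on_def partition_on_def extend_root_def e_def extend_block_def)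
  moreover have "e B \<in> extend_root n \<pi>" "1 \<in> e B" "Suc n \<in> e B"
    using B by (auto simp: extend_root_def e_def extend_block_def)
  ultimately show ?thesis unfolding NC_irr_def by blast
qed

lemma restrict_last_extend_root:
  assumes "\<pi> \<in> NC n"
  shows "restrict_last n (extend_root n \<pi>) = \<pi>"
proof -
  have "Suc n \<notin> V" if "V \<in> \<pi>" for V
    using NC_on_block(1)[of \<pi> "{1..n}" V] assms that by (auto simp: NC_eq_NC_on)
  then have "extend_block n V - {Suc n} = V" if "V \<in> \<pi>" for V
    using that by (auto simp: extend_block_def)
  then show ?thesis by (simp add: restrict_last_def extend_root_def image_image)
qed

lemma restrict_last_NC:
  assumes \<pi>: "\<pi> \<in> NC_irr (Suc n)" and n: "n \<ge> 1"
  shows "restrict_last n \<pi> \<in> NC n" "extend_root n (restrict_last n \<pi>) = \<pi>"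
proof -
  obtain B where B: "B \<in> \<pi>" "1 \<in> B" "Suc n \<in> B" and \<pi>': "\<pi> \<in> NC_on {1..Suc n}"
    using NC_irrD[OF \<pi>] .
  have sub: "V \<subseteq> {1..Suc n}" "V \<noteq> {}" if "V \<in> \<pi>" for V
    using NC_on_block[OF \<pi>' that] by auto
  have disj: "V = W" if "V \<in> \<pi>" "W \<in> \<pi>" "i \<in> V" "i \<in> W" for V W i
    using NC_on_same_block[OF \<pi>'] that by blast
  have "\<Union>\<pi> = {1..Suc n}" using \<pi>' by (simp add: NC_on_def partition_on_def)
  moreover have "\<Union>(restrict_last n \<pi>) = \<Union>\<pi> - {Suc n}" by (auto simp: restrict_last_def)
  ultimately have "\<Union>(restrict_last n \<pi>) = {1..n}" by auto
  moreover have "disjoint (restrict_last n \<pi>)"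
    unfolding disjoint_def restrict_last_def using disj by blast
  \<comment> \<open>Only B contains \<open>Suc n\<close>, and it retains 1, a different point
    because \<open>n \<ge> 1\<close>.\<close>
  moreover have "V - {Suc n} \<noteq> {}" if "V \<in> \<pi>" for V
  proof (cases "V = B")
    case True
    then show ?thesis using B n by auto
  next
    case False
    then have "Suc n \<notin> V" using disj[OF that B(1) _ B(3)] by blast
    then show ?thesis using sub[OF that] by auto
  qed
  moreover have "noncrossing (restrict_last n \<pi>)"
    unfolding noncrossing_def restrict_last_def using NC_on_crossing[OF \<pi>'] by blast
  ultimately show "restrict_last n \<pi> \<in> NC n"
    unfolding NC_eq_NC_on NC_on_def partition_on_def restrict_last_def by fastforce
  have "extend_block n (V - {Suc n}) = V" if "V \<in> \<pi>" for V
  proof (cases "V = B")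
    case True
    then show ?thesis using B n by (auto simp: extend_block_def)
  next
    case False
    then have "Suc n \<notin> V" "1 \<notin> V" using disj[OF that B(1)] B by blast+
    then show ?thesis by (simp add: extend_block_def)
  qed
  then show "extend_root n (restrict_last n \<pi>) = \<pi>" by (simp add: extend_root_def restrict_last_def image_image)
qed

lemma sum_NC_irr_Suc:
  assumes "n \<ge> 1"
  shows "(\<Sum>\<pi>\<in>NC_irr (Suc n). G \<pi>) = (\<Sum>\<pi>\<in>NC n. G (extend_root n \<pi>))"
  by (rule sum.reindex_bij_witness[where j = "restrict_last n" and i = "extend_root n"])
    (simp_all add: restrict_last_NC[OF _ assms] restrict_last_extend_root extend_root_NC_irr[OF _ assms])

text \<open>The nested count of the block of 1 may grow when its hull reaches \<open>Suc n\<close>,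
  hence its factor \<open>f\<close> ignores the count. A block without 1 has minimum above 1, so its
  hull contains neither the old nor the new root block.\<close>

lemma weight_extend_root:
  assumes \<pi>: "\<pi> \<in> NC n" and n: "n \<ge> 1"
  shows "weight (\<lambda>W k. if 1 \<in> W then f W else g W k) (extend_root n \<pi>) =
    weight (\<lambda>W k. if 1 \<in> W then f (insert (Suc n) W) else g W k) \<pi>"
proof -
  have \<pi>': "\<pi> \<in> NC_on {1..n}" using \<pi> by (simp add: NC_eq_NC_on)
  note sub = NC_on_block[OF \<pi>'] NC_on_finite[OF \<pi>']
  let ?e = "extend_block n"
  have inj: "inj_on ?e \<pi>"
  proof (rule inj_on_inverseI)
    fix W assume "W \<in> \<pi>"
    then show "?e W - {Suc n} = W" using sub(1)[of W] by (auto simp: extend_block_def)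
  qed
  have "nested (extend_root n \<pi>) W = nested \<pi> W" if W: "W \<in> \<pi>" "1 \<notin> W" for W
  proof -
    have "Min W \<in> W" using sub W by auto
    then have "Min W > 1" using sub(1)[OF W(1)] W(2) by (metis atLeastAtMost_iff le_neq_implies_less subsetD)
    then have "{U \<in> extend_root n \<pi>. U \<subseteq> {Min W..Max W}} = {U\<in>\<pi>. U \<subseteq> {Min W..Max W}}"
      by (force simp: extend_root_def extend_block_def)
    then show ?thesis by (simp add: nested_def)
  qed
  then show ?thesis
    using n unfolding weight_def
    by (subst (1) extend_root_def, subst prod.reindex[OF inj]) (auto intro!: prod.cong simp: extend_block_def)
qed

section \<open>Sums over partitions as functions of the list of entries\<close>

lemma sorted_list_of_set_shift:
  assumes "finite W"
  shows "sorted_list_of_set ((+) p ` W) = map ((+) p) (sorted_list_of_set (W :: nat set))"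
  using assms
  by (intro sorted_distinct_set_unique) (auto simp: sorted_map distinct_map)

lemma entries_take:
  assumes "W \<subseteq> {1..p}"
  shows "entries xs W = entries (take p xs) W"
proof -
  have "finite W" using assms by (rule finite_subset) simp
  then show ?thesis using assms by (fastforce simp: entries_def)
qed

lemma entries_drop:
  assumes "W \<subseteq> {1..n}" "p + n \<le> length xs"
  shows "entries xs ((+) p ` W) = entries (drop p xs) W"
proof -
  have fin: "finite W" using assms(1) by (rule finite_subset) simp
  have "xs ! (p + i - 1) = drop p xs ! (i - 1)" if "i \<in> W" for i
    using assms that by (subst nth_drop) force+
  then show ?thesis by (simp add: entries_def sorted_list_of_set_shift[OF fin] fin)
qed

lemma entries_insert_last:
  assumes "W \<subseteq> {1..length xs}"
  shows "entries (xs @ [y]) (insert (Suc (length xs)) W) = entries xs W @ [y]"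
proof -
  have fin: "finite W" using assms by (rule finite_subset) simp
  have "sorted_list_of_set (insert (Suc (length xs)) W) = sorted_list_of_set W @ [Suc (length xs)]"
    using assms fin
    by (intro sorted_distinct_set_unique)
      (auto simp: sorted_append simp del: sorted_list_of_set.fold_insort_key.insert_remove)
  moreover have "entries (xs @ [y]) W = entries xs W"
    using entries_take[OF assms, of "xs @ [y]"] by simp
  ultimately show ?thesis by (simp add: entries_def)
qed

section \<open>Partition sums with a distinguished root block\<close>

text \<open>The block of 1 has its own factor \<open>f\<close>: its letters can be absorbed into
  \<open>f\<close> while \<open>c\<close> stays fixed, and differentiation in t can strip its
  coefficient.\<close>

definition root_weight ::
    "(nat \<Rightarrow> 'a list \<Rightarrow> 'b) \<Rightarrow> (nat \<Rightarrow> 'b) \<Rightarrow> ('a list \<Rightarrow> 'b::comm_ring_1) \<Rightarrow> 'a list \<Rightarrow> nat set \<Rightarrow> nat \<Rightarrow> 'b" where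
  "root_weight f q c xs W k = (if 1 \<in> W then f k (entries xs W) else q k * c (entries xs W))"

text \<open>With \<open>q k = 1\<close> and free cumulants \<open>c\<close> these are the moments;
  \<open>q = reciprocal t\<close> and monotone cumulants give M_t.\<close>

definition nc_sum :: "(nat \<Rightarrow> 'b) \<Rightarrow> ('a list \<Rightarrow> 'b::comm_ring_1) \<Rightarrow> 'a list \<Rightarrow> 'b" where
  "nc_sum q c xs = (\<Sum>\<pi>\<in>NC (length xs). weight (\<lambda>W k. q k * c (entries xs W)) \<pi>)"

definition irr_sum :: "(nat \<Rightarrow> 'b) \<Rightarrow> ('a list \<Rightarrow> 'b::comm_ring_1) \<Rightarrow> 'a list \<Rightarrow> 'b" where
  "irr_sum q c xs = (\<Sum>\<pi>\<in>NC_irr (length xs). weight (\<lambda>W k. q k * c (entries xs W)) \<pi>)"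

definition nc_root ::
    "(nat \<Rightarrow> 'a list \<Rightarrow> 'b) \<Rightarrow> (nat \<Rightarrow> 'b) \<Rightarrow> ('a list \<Rightarrow> 'b::comm_ring_1) \<Rightarrow> 'a list \<Rightarrow> 'b" where
  "nc_root f q c xs = (\<Sum>\<pi>\<in>NC (length xs). weight (root_weight f q c xs) \<pi>)"

definition irr_root ::
    "(nat \<Rightarrow> 'a list \<Rightarrow> 'b) \<Rightarrow> (nat \<Rightarrow> 'b) \<Rightarrow> ('a list \<Rightarrow> 'b::comm_ring_1) \<Rightarrow> 'a list \<Rightarrow> 'b" where
  "irr_root f q c xs = (\<Sum>\<pi>\<in>NC_irr (length xs). weight (root_weight f q c xs) \<pi>)"

lemma nc_sum_root: "nc_sum q c = nc_root (\<lambda>k l. q k * c l) q c"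
  by (simp add: nc_sum_def nc_root_def root_weight_def[abs_def] fun_eq_iff)

lemma irr_sum_root: "irr_sum q c = irr_root (\<lambda>k l. q k * c l) q c"
  by (simp add: irr_sum_def irr_root_def root_weight_def[abs_def] fun_eq_iff)

lemma weight_cong:
  "(\<And>W k. W \<in> \<pi> \<Longrightarrow> F W k = G W k) \<Longrightarrow> weight F \<pi> = weight G \<pi>"
  by (simp add: weight_def)

lemma NC_block:
  assumes "\<pi> \<in> NC n" "W \<in> \<pi>"
  shows "W \<subseteq> {1..n}" "W \<noteq> {}"
  using NC_on_block assms by (auto simp: NC_eq_NC_on)

lemma NC_irr_subset: "NC_irr n \<subseteq> NC n"
  by (auto simp: NC_irr_def)

text \<open>Lifts the cut to words. The assumptions say that blocks left of the cut see only a
  prefix of the word and blocks right of it only the remaining suffix, with their own weight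
  \<open>G\<close>.\<close>

lemma sum_weight_lists:
  assumes left: "\<And>p W k. W \<subseteq> {1..p} \<Longrightarrow> F (x # xs) W k = F (take p (x # xs)) W k"
    and right: "\<And>p W k. W \<subseteq> {1..length xs - p} \<Longrightarrow> p \<le> length xs \<Longrightarrow>
      F (x # xs) ((+) (Suc p) ` W) k = G (drop p xs) W k"
  shows "(\<Sum>\<pi>\<in>NC (Suc (length xs)). weight (F (x # xs)) \<pi>) =
    conv (\<lambda>u. \<Sum>\<pi>\<in>NC_irr (Suc (length u)). weight (F (x # u)) \<pi>)
      (\<lambda>v. \<Sum>\<pi>\<in>NC (length v). weight (G v) \<pi>) xs"
proof -
  let ?n = "length xs"
  \<comment> \<open>Cut positions start at 1; written as \<open>Suc p\<close>, they put
    \<open>x\<close> and \<open>p\<close> letters of \<open>xs\<close> to the left.\<close>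
  have "(\<Sum>\<pi>\<in>NC (Suc ?n). weight (F (x # xs)) \<pi>) =
      (\<Sum>p\<le>?n. (\<Sum>\<pi>\<in>NC_irr (Suc p). weight (F (x # xs)) \<pi>) *
         (\<Sum>\<pi>\<in>NC (?n - p). weight (\<lambda>W. F (x # xs) ((+) (Suc p) ` W)) \<pi>))"
    using sum_weight_NC[of "Suc ?n" "F (x # xs)"]
    by (simp add: sum.atLeast_Suc_atMost_Suc_shift atMost_atLeast0 del: sum.cl_ivl_Suc)
  also have "\<dots> = (\<Sum>p\<le>?n. (\<Sum>\<pi>\<in>NC_irr (Suc p). weight (F (x # take p xs)) \<pi>) *
         (\<Sum>\<pi>\<in>NC (?n - p). weight (G (drop p xs)) \<pi>))"
  proof (intro sum.cong refl arg_cong2[of _ _ _ _ "(*)"])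
    fix p \<pi> assume "p \<in> {..?n}" "\<pi> \<in> NC_irr (Suc p)"
    then show "weight (F (x # xs)) \<pi> = weight (F (x # take p xs)) \<pi>"
      using NC_block(1)[of \<pi> "Suc p"] NC_irr_subset[of "Suc p"] left[of _ "Suc p"]
      by (intro weight_cong) (simp add: subset_iff)
  next
    fix p \<pi> assume "p \<in> {..?n}" "\<pi> \<in> NC (?n - p)"
    then show "weight (\<lambda>W. F (x # xs) ((+) (Suc p) ` W)) \<pi> = weight (G (drop p xs)) \<pi>"
      using NC_block(1)[of \<pi> "?n - p"] right[of _ p] by (auto intro!: weight_cong)
  qed
  also have "\<dots> = conv (\<lambda>u. \<Sum>\<pi>\<in>NC_irr (Suc (length u)). weight (F (x # u)) \<pi>)
      (\<lambda>v. \<Sum>\<pi>\<in>NC (length v). weight (G v) \<pi>) xs"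
    unfolding conv_sum by (intro sum.cong) (auto simp: min_def)
  finally show ?thesis .
qed

text \<open>No block right of the cut contains 1, so the special factor \<open>f\<close> stays with
  the irreducible part and the remainder is a plain \<open>nc_sum\<close>.\<close>

lemma nc_root_Cons: "nc_root f q c (x # xs) = conv (\<lambda>u. irr_root f q c (x # u)) (nc_sum q c) xs"
proof -
  have "root_weight f q c (x # xs) ((+) (Suc p) ` W) k = q k * c (entries (drop p xs) W)"
    if W: "W \<subseteq> {1..length xs - p}" "p \<le> length xs" for p W k
  proof -
    have "1 \<notin> (+) (Suc p) ` W" using W by auto
    moreover have "entries (x # xs) ((+) (Suc p) ` W) = entries (drop p xs) W"
      using W entries_drop[of W "length xs - p" "Suc p" "x # xs"] by simp
    ultimately show ?thesis by (simp add: root_weight_def)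
  qed
  moreover have "root_weight f q c (x # xs) W k = root_weight f q c (take p (x # xs)) W k"
    if "W \<subseteq> {1..p}" for p W k
    using entries_take[OF that, of "x # xs"] by (simp add: root_weight_def)
  ultimately show ?thesis
    using sum_weight_lists[of "root_weight f q c" x xs "\<lambda>v W k. q k * c (entries v W)"]
    by (simp add: nc_root_def irr_root_def nc_sum_def[abs_def])
qed

lemma nc_sum_Cons: "nc_sum q c (x # xs) = conv (\<lambda>u. irr_sum q c (x # u)) (nc_sum q c) xs"
  using nc_root_Cons[of "\<lambda>k l. q k * c l" q c x xs] by (simp add: nc_sum_root irr_sum_root)

lemma nc_sum_Nil [simp]: "nc_sum q c [] = 1"
  by (simp add: nc_sum_def NC_def partition_on_empty weight_def
      cong: conj_cong)

lemma NC_irr_1: "NC_irr (Suc 0) = {{{1}}}"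
proof -
  have "\<pi> = {{1}}" if \<pi>: "\<pi> \<in> NC_irr (Suc 0)" for \<pi>
  proof -
    obtain V where V: "V \<in> \<pi>" "\<pi> \<in> NC_on {1..Suc 0}" using NC_irrD[OF \<pi>] by metis
    have "W = {1}" if "W \<in> \<pi>" for W
      using NC_on_block[OF V(2) that] by auto
    then show ?thesis using V(1) by blast
  qed
  moreover have "{{1}} \<in> NC_irr (Suc 0)"
    using one_block_NC[of 1] by (simp add: NC_irr_def)
  ultimately show ?thesis by blast
qed

lemma irr_root_singleton: "irr_root (\<lambda>_. f) q c [x] = f [x]"
  by (simp add: irr_root_def NC_irr_1 weight_def root_weight_def entries_def)

text \<open>Deleting the last letter from the block of 1 is absorbed by changing its factor to
  \<open>\<lambda>z. f (z @ [y])\<close>.\<close>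

lemma irr_root_snoc:
  assumes "xs \<noteq> []"
  shows "irr_root (\<lambda>_. f) q c (xs @ [y]) = nc_root (\<lambda>_ z. f (z @ [y])) q c xs"
proof -
  let ?n = "length xs"
  have n: "?n \<ge> 1" using assms by (cases xs) auto
  have "irr_root (\<lambda>_. f) q c (xs @ [y]) =
      (\<Sum>\<pi>\<in>NC ?n. weight (root_weight (\<lambda>_. f) q c (xs @ [y])) (extend_root ?n \<pi>))"
    using sum_NC_irr_Suc[OF n] by (simp add: irr_root_def)
  also have "\<dots> = nc_root (\<lambda>_ z. f (z @ [y])) q c xs"
    unfolding nc_root_def
  proof (rule sum.cong)
    fix \<pi> assume \<pi>: "\<pi> \<in> NC ?n"
    have "weight (root_weight (\<lambda>_. f) q c (xs @ [y])) (extend_root ?n \<pi>) =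
       weight (\<lambda>W k. if 1 \<in> W then f (entries (xs @ [y]) (insert (Suc ?n) W))
         else q k * c (entries (xs @ [y]) W)) \<pi>"
      unfolding root_weight_def[abs_def] by (rule weight_extend_root[OF \<pi> n])
    also have "\<dots> = weight (root_weight (\<lambda>_ z. f (z @ [y])) q c xs) \<pi>"
    proof (rule weight_cong)
      fix W k assume "W \<in> \<pi>"
      then have W: "W \<subseteq> {1..?n}" using NC_block[OF \<pi>] by blast
      show "(if 1 \<in> W then f (entries (xs @ [y]) (insert (Suc ?n) W)) else q k * c (entries (xs @ [y]) W)) =
        root_weight (\<lambda>_ z. f (z @ [y])) q c xs W k"
        using entries_insert_last[OF W, of y] entries_take[OF W, of "xs @ [y]"]
        by (simp add: root_weight_def)
    qed
    finally show "weight (root_weight (\<lambda>_. f) q c (xs @ [y])) (extend_root ?n \<pi>) =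
      weight (root_weight (\<lambda>_ z. f (z @ [y])) q c xs) \<pi>" .
  qed simp
  finally show ?thesis .
qed

text \<open>The letters of the block of 1 form a subword, and each gap carries an independent
  non-crossing partition. Formally: cut after that block, delete its last letter, apply induction to
  the changed \<open>f\<close>, and compare with \<open>insertion_right\<close>.\<close>

lemma nc_root_insertion:
  "nc_root (\<lambda>_. f) q c (x # xs) = insertion (nc_sum q c) (nc_sum q c) (\<lambda>z. f (x # z)) xs"
proof (induction "length xs" arbitrary: xs f rule: less_induct)
  case less
  let ?M = "nc_sum q c"
  have "nc_root (\<lambda>_. f) q c (x # xs) = (\<Sum>k\<le>length xs. irr_root (\<lambda>_. f) q c (x # take k xs) * ?M (drop k xs))"
    by (simp add: nc_root_Cons conv_sum)
  \<comment> \<open>The term k = 0 is the cut where the block of 1 is just \<open>x\<close>.\<close>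
  also have "\<dots> = f [x] * ?M xs +
      (\<Sum>k<length xs. irr_root (\<lambda>_. f) q c (x # take (Suc k) xs) * ?M (drop (Suc k) xs))"
    by (simp add: sum.atMost_shift irr_root_singleton)
  also have "(\<Sum>k<length xs. irr_root (\<lambda>_. f) q c (x # take (Suc k) xs) * ?M (drop (Suc k) xs)) =
      (\<Sum>k<length xs. insertion ?M ?M (\<lambda>z. f (x # z @ [xs ! k])) (take k xs) * ?M (drop (Suc k) xs))"
  proof (intro sum.cong refl arg_cong2[of _ _ _ _ "(*)"])
    fix k assume k: "k \<in> {..<length xs}"
    have "irr_root (\<lambda>_. f) q c (x # take (Suc k) xs) = nc_root (\<lambda>_ z. f (z @ [xs ! k])) q c (x # take k xs)"
      using k irr_root_snoc[of "x # take k xs" f q c "xs ! k"] by (simp add: take_Suc_conv_app_nth)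
    also have "\<dots> = insertion ?M ?M (\<lambda>z. f (x # z @ [xs ! k])) (take k xs)"
      using less[of "take k xs" "\<lambda>z. f (z @ [xs ! k])"] k by simp
    finally show "irr_root (\<lambda>_. f) q c (x # take (Suc k) xs) =
      insertion ?M ?M (\<lambda>z. f (x # z @ [xs ! k])) (take k xs)" .
  qed
  finally show ?case
    using insertion_right[of ?M ?M "\<lambda>z. f (x # z)" xs] by simp
qed

lemma irr_root_insertion:
  "irr_root (\<lambda>_. f) q c (x # xs @ [y]) = insertion (nc_sum q c) (nc_sum q c) (\<lambda>z. f (x # z @ [y])) xs"
  using irr_root_snoc[of "x # xs" f q c y] nc_root_insertion[of "\<lambda>z. f (z @ [y])" q c x xs] by simp

section \<open>Boolean moments\<close>

definition interval_sum :: "('a list \<Rightarrow> 'b::comm_ring_1) \<Rightarrow> 'a list \<Rightarrow> 'b" where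
  "interval_sum b xs = (\<Sum>\<pi>\<in>interval_partitions (length xs). mult_ext b \<pi> xs)"

lemma interval_partitions_subset_NC: "interval_partitions n \<subseteq> NC n"
proof
  fix \<pi> assume *: "\<pi> \<in> interval_partitions n"
  then have p: "partition_on {1..n} \<pi>" by (rule interval_partition_on)
  have "noncrossing \<pi>"
    unfolding noncrossing_def
  proof (intro ballI impI)
    fix V W i j k l
    assume V: "V \<in> \<pi>" "W \<in> \<pi>" "i \<in> V" "j \<in> W" "k \<in> V" "l \<in> W" "i < j" "j < k" "k < l"
    then obtain a b where "V = {a..b}" using * by (auto simp: interval_partitions_def)
    then have "j \<in> V" using V by simp
    then show "V = W" using p V by (auto simp: partition_on_def disjoint_def)
  qed
  then show "\<pi> \<in> NC n" using p by (simp add: NC_eq_NC_on NC_on_def)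
qed

text \<open>
  Interval partitions are the non-crossing partitions of nonzero weight, so that the cut after the
  block of 1 also covers the Boolean case.
\<close>

definition interval_weight :: "('a list \<Rightarrow> 'b::comm_ring_1) \<Rightarrow> 'a list \<Rightarrow> nat set \<Rightarrow> nat \<Rightarrow> 'b" where
  "interval_weight b xs W k = (if \<exists>i j. W = {i..j} then b (entries xs W) else 0)"

lemma weight_interval:
  assumes "\<pi> \<in> NC n"
  shows "weight (interval_weight b xs) \<pi> = (if \<pi> \<in> interval_partitions n then mult_ext b \<pi> xs else 0)"
proof (cases "\<pi> \<in> interval_partitions n")
  case True
  then show ?thesis
    by (auto simp: weight_def interval_weight_def mult_ext_def interval_partitions_def intro!: prod.cong)
next
  case False
  then obtain V where "V \<in> \<pi>" "\<not> (\<exists>i j. V = {i..j})"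
    using assms by (auto simp: NC_def interval_partitions_def)
  moreover have "finite \<pi>" using NC_on_finite(1)[of \<pi> "{1..n}"] assms by (simp add: NC_eq_NC_on)
  ultimately show ?thesis using False
    by (auto simp: weight_def interval_weight_def intro!: prod_zero bexI[of _ V])
qed

lemma interval_sum_weight:
  "interval_sum b xs = (\<Sum>\<pi>\<in>NC (length xs). weight (interval_weight b xs) \<pi>)"
  unfolding interval_sum_def
  by (rule sum.mono_neutral_cong_left)
    (use interval_partitions_subset_NC[of "length xs"] in \<open>auto simp: weight_interval subset_iff\<close>)

lemma NC_irr_interval: "n \<ge> 1 \<Longrightarrow> NC_irr n \<inter> interval_partitions n = {{{1..n}}}"
proof -
  assume n: "n \<ge> 1"
  have "\<pi> = {{1..n}}" if \<pi>: "\<pi> \<in> NC_irr n" "\<pi> \<in> interval_partitions n" for \<pi>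
  proof -
    obtain V where V: "V \<in> \<pi>" "1 \<in> V" "n \<in> V" and \<pi>': "\<pi> \<in> NC_on {1..n}" using NC_irrD[OF \<pi>(1)] .
    obtain i j where "V = {i..j}" using V \<pi>(2) by (auto simp: interval_partitions_def)
    then have Vn: "V = {1..n}" using V NC_on_block(1)[OF \<pi>' V(1)] by auto
    have "W = V" if "W \<in> \<pi>" for W
      using NC_on_block[OF \<pi>' that] NC_on_same_block[OF \<pi>' that V(1)] Vn by blast
    then show ?thesis using V(1) Vn by blast
  qed
  moreover have "{{1..n}} \<in> NC_irr n"
    using one_block_NC[OF n] n by (simp add: NC_irr_def)
  ultimately show ?thesis using one_block_interval[OF n] by blast
qed

text \<open>By \<open>NC_irr_interval\<close> the irreducible sum for \<open>interval_weight\<close>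
  reduces to the one-block term \<open>b (x # u)\<close>, so the general cut becomes M = 1 + b
  M.\<close>

lemma interval_sum_Cons:
  fixes b :: "'a list \<Rightarrow> 'b::comm_ring_1"
  shows "interval_sum b (x # xs) = conv (\<lambda>u. b (x # u)) (interval_sum b) xs"
proof -
  have "interval_weight b (x # xs) ((+) (Suc p) ` W) k = interval_weight b (drop p xs) W k"
    if W: "W \<subseteq> {1..length xs - p}" "p \<le> length xs" for p W k
  proof -
    have e: "entries (x # xs) ((+) (Suc p) ` W) = entries (drop p xs) W"
      using W entries_drop[of W "length xs - p" "Suc p" "x # xs"] by simp
    have "(\<exists>i j. (+) (Suc p) ` W = {i..j}) \<longleftrightarrow> (\<exists>i j. W = {i..j})"
    proof
      assume "\<exists>i j. W = {i..j}"
      then show "\<exists>i j. (+) (Suc p) ` W = {i..j}" by (metis image_add_atLeastAtMost)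
    next
      assume "\<exists>i j. (+) (Suc p) ` W = {i..j}"
      then obtain i j where ij: "(+) (Suc p) ` W = {i..j}" by blast
      show "\<exists>i j. W = {i..j}"
      proof (cases "i \<le> j")
        case True
        \<comment> \<open>Membership of \<open>i\<close> in the shifted set gives
          \<open>Suc p \<le> i\<close>, which makes the truncated subtractions below exact.\<close>
        then have "i \<in> (+) (Suc p) ` W" using ij by simp
        then have "Suc p \<le> i" by auto
        then have "(+) (Suc p) ` W = (+) (Suc p) ` {i - Suc p..j - Suc p}"
          using ij True unfolding image_add_atLeastAtMost by simp
        then have "W = {i - Suc p..j - Suc p}"
            by (subst (asm) inj_image_eq_iff) (auto simp: inj_def)
        then show ?thesis by blast
      next
        case False
        then have "W = {1..0}" using ij by simp
        then show ?thesis by blast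
      qed
    qed
    then show ?thesis by (simp only: interval_weight_def e)
  qed
  moreover have "interval_weight b (x # xs) W k = interval_weight b (take p (x # xs)) W k"
    if "W \<subseteq> {1..p}" for p W k
    using entries_take[OF that, of "x # xs"] by (simp add: interval_weight_def)
  ultimately have "interval_sum b (x # xs) =
    conv (\<lambda>u. \<Sum>\<pi>\<in>NC_irr (Suc (length u)). weight (interval_weight b (x # u)) \<pi>) (interval_sum b) xs"
    using sum_weight_lists[of "interval_weight b" x xs "interval_weight b"]
    by (simp add: interval_sum_weight[abs_def])
  also have "(\<lambda>u. \<Sum>\<pi>\<in>NC_irr (Suc (length u)). weight (interval_weight b (x # u)) \<pi>) = (\<lambda>u. b (x # u))"
  proof
    fix u :: "'a list"
    have fin: "finite (NC_irr (Suc (length u)))"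
      by (rule finite_subset[OF NC_irr_subset finite_NC])
    have "(\<Sum>\<pi>\<in>NC_irr (Suc (length u)). weight (interval_weight b (x # u)) \<pi>) =
      (\<Sum>\<pi>\<in>NC_irr (Suc (length u)) \<inter> interval_partitions (Suc (length u)). mult_ext b \<pi> (x # u))"
      using NC_irr_subset[of "Suc (length u)"] fin
      by (intro sum.mono_neutral_cong_right) (auto simp: weight_interval[of _ "Suc (length u)"] subset_iff split: if_splits)
    also have "\<dots> = b (x # u)"
      using mult_ext_one_block[of b "x # u"] by (simp add: NC_irr_interval del: mult_ext_one_block)
    finally show "(\<Sum>\<pi>\<in>NC_irr (Suc (length u)). weight (interval_weight b (x # u)) \<pi>) = b (x # u)" .
  qed
  finally show ?thesis .
qed

lemma interval_sum_Nil [simp]: "interval_sum b [] = 1"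
  by (simp add: interval_sum_def interval_partitions_def partition_on_empty mult_ext_def cong: conj_cong)

section \<open>Dual numbers and the monotone flow\<close>

lemma dual_simps [simp]:
  "std (x + y) = std x + std y" "infin (x + y) = infin x + infin y"
  "std (- x) = - std x" "infin (- x) = - infin x"
  "std (x * y) = std x * std y" "infin (x * y) = std x * infin y + infin x * std y"
  "std 0 = 0" "infin 0 = 0" "std 1 = 1" "infin 1 = 0"
  "std (of_complex c) = c" "infin (of_complex c) = 0"
  by (simp_all add: plus_dual_def uminus_dual_def times_dual_def zero_dual_def one_dual_def of_complex_def)

lemma of_complex_mult: "of_complex (a * b) = of_complex a * of_complex b"
  by (simp add: dual.expand)

lemma of_complex_1 [simp]: "of_complex 1 = 1"
  by (simp add: dual.expand)

lemma of_complex_power: "of_complex (a ^ n) = of_complex a ^ n"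
  by (induction n) (simp_all add: of_complex_mult)

lemma of_complex_prod: "of_complex (\<Prod>i\<in>A. f i) = (\<Prod>i\<in>A. of_complex (f i))"
  by (induction A rule: infinite_finite_induct) (simp_all add: of_complex_mult)

lemma of_complex_mult_Dual: "of_complex c * Dual a b = Dual (c * a) (c * b)"
  by (simp add: dual.expand)

lemma sum_Dual: "(\<Sum>i\<in>A. Dual (f i) (g i)) = Dual (\<Sum>i\<in>A. f i) (\<Sum>i\<in>A. g i)"
  by (induction A rule: infinite_finite_induct) (simp_all add: dual.expand)

text \<open>The Leibniz rule: since hbar squares to zero, each term of the infinitesimal part takes
  that part from exactly one factor. Over a partition this gives \<open>partial_ext\<close>.\<close>

lemma prod_Dual:
  "finite A \<Longrightarrow> (\<Prod>i\<in>A. Dual (f i) (g i)) = Dual (\<Prod>i\<in>A. f i) (\<Sum>i\<in>A. g i * (\<Prod>j\<in>A - {i}. f j))"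
proof (induction A rule: finite_induct)
  case (insert a A)
  have "(\<Sum>i\<in>A. g i * (\<Prod>j\<in>insert a A - {i}. f j)) = f a * (\<Sum>i\<in>A. g i * (\<Prod>j\<in>A - {i}. f j))"
    unfolding sum_distrib_left
  proof (rule sum.cong)
    fix i assume "i \<in> A"
    then have "insert a A - {i} = insert a (A - {i})" using insert by auto
    then show "g i * (\<Prod>j\<in>insert a A - {i}. f j) = f a * (g i * (\<Prod>j\<in>A - {i}. f j))"
      using insert by simp
  qed simp
  moreover have "insert a A - {a} = A" using insert by auto
  ultimately show ?case using insert by (simp add: times_dual_def)
qed (simp add: one_dual_def)

lemma mult_ext_Dual:
  "finite \<pi> \<Longrightarrow> mult_ext (\<lambda>l. Dual (f l) (g l)) \<pi> xs = Dual (mult_ext f \<pi> xs) (partial_ext f g \<pi> xs)"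
  by (simp add: mult_ext_def partial_ext_def prod_Dual)

section \<open>Componentwise derivatives of dual-valued functions\<close>

definition has_dual_derivative :: "(complex \<Rightarrow> dual) \<Rightarrow> (complex \<Rightarrow> dual) \<Rightarrow> bool" where
  "has_dual_derivative F F' \<longleftrightarrow> (\<forall>t. ((\<lambda>t. std (F t)) has_field_derivative std (F' t)) (at t) \<and>
     ((\<lambda>t. infin (F t)) has_field_derivative infin (F' t)) (at t))"

lemma has_dual_derivative_const: "has_dual_derivative (\<lambda>_. c) (\<lambda>_. 0)"
  by (simp add: has_dual_derivative_def)

lemma has_dual_derivative_add:
  "has_dual_derivative F F' \<Longrightarrow> has_dual_derivative G G' \<Longrightarrow>
    has_dual_derivative (\<lambda>t. F t + G t) (\<lambda>t. F' t + G' t)"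
  by (auto simp: has_dual_derivative_def intro: DERIV_add)

lemma has_dual_derivative_mult:
  "has_dual_derivative F F' \<Longrightarrow> has_dual_derivative G G' \<Longrightarrow>
    has_dual_derivative (\<lambda>t. F t * G t) (\<lambda>t. F' t * G t + F t * G' t)"
  by (auto simp: has_dual_derivative_def intro!: derivative_eq_intros)

lemma has_dual_derivative_sum:
  "(\<And>i. i \<in> A \<Longrightarrow> has_dual_derivative (F i) (F' i)) \<Longrightarrow>
    has_dual_derivative (\<lambda>t. \<Sum>i\<in>A. F i t) (\<lambda>t. \<Sum>i\<in>A. F' i t)"
  by (induction A rule: infinite_finite_induct)
    (simp_all add: has_dual_derivative_const has_dual_derivative_add)

lemma has_dual_derivative_shift:
  assumes "has_dual_derivative F F'"
  shows "has_dual_derivative (\<lambda>t. F (c + t)) (\<lambda>t. F' (c + t))"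
  unfolding has_dual_derivative_def
proof (intro allI conjI)
  fix t
  have *: "((\<lambda>t. std (F t)) has_field_derivative std (F' (t + c))) (at (t + c))"
    "((\<lambda>t. infin (F t)) has_field_derivative infin (F' (t + c))) (at (t + c))"
    using assms by (auto simp: has_dual_derivative_def)
  show "((\<lambda>t. std (F (c + t))) has_field_derivative std (F' (c + t))) (at t)"
    "((\<lambda>t. infin (F (c + t))) has_field_derivative infin (F' (c + t))) (at t)"
    using *[THEN DERIV_shift[THEN iffD1]] by (simp_all add: add.commute)
qed

lemma has_dual_derivative_unique:
  assumes "has_dual_derivative F F'" "has_dual_derivative G F'" "F s = G s"
  shows "F t = G t"
proof -
  have "((\<lambda>t. std (F t) - std (G t)) has_field_derivative 0) (at t)"
    "((\<lambda>t. infin (F t) - infin (G t)) has_field_derivative 0) (at t)" for t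
    using assms(1,2) by (auto simp: has_dual_derivative_def intro!: derivative_eq_intros)
  then obtain c d where "\<And>t. std (F t) - std (G t) = c" "\<And>t. infin (F t) - infin (G t) = d"
    using has_field_derivative_zero_constant[of UNIV "\<lambda>t. std (F t) - std (G t)"]
      has_field_derivative_zero_constant[of UNIV "\<lambda>t. infin (F t) - infin (G t)"] by auto
  moreover from this[of s] have "c = 0" "d = 0" using assms(3) by auto
  ultimately show ?thesis by (simp add: dual.expand)
qed

lemma has_dual_derivative_power:
  assumes "n > 0"
  shows "has_dual_derivative (\<lambda>t. of_complex (t ^ n / of_nat n) * c) (\<lambda>t. of_complex (t ^ (n - 1)) * c)"
  using assms unfolding has_dual_derivative_def
  by (auto intro!: derivative_eq_intros)

lemma has_dual_derivative_conv:
  assumes "\<And>u. length u \<le> length xs \<Longrightarrow> has_dual_derivative (\<lambda>t. p t u) (\<lambda>t. p' t u)"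
    and "\<And>u. length u \<le> length xs \<Longrightarrow> has_dual_derivative (\<lambda>t. q t u) (\<lambda>t. q' t u)"
  shows "has_dual_derivative (\<lambda>t. conv (p t) (q t) xs) (\<lambda>t. conv (p' t) (q t) xs + conv (p t) (q' t) xs)"
  unfolding conv_sum sum.distrib[symmetric]
  by (intro has_dual_derivative_sum has_dual_derivative_mult assms) auto

lemma has_dual_derivative_insertion:
  assumes "\<And>u. has_dual_derivative (\<lambda>t. f t u) (\<lambda>t. f' t u)"
  shows "has_dual_derivative (\<lambda>t. insertion g m (f t) xs) (\<lambda>t. insertion g m (f' t) xs)"
proof -
  have scale: "has_dual_derivative (\<lambda>t. c * F t) (\<lambda>t. c * F' t)" if "has_dual_derivative F F'" for c F F'
    using has_dual_derivative_mult[OF has_dual_derivative_const that, of c] by simp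
  show ?thesis
    using assms
    by (induction xs arbitrary: g f f') (simp_all add: scale has_dual_derivative_add)
qed

section \<open>The monotone moments M_t as a flow\<close>

definition reciprocal :: "complex \<Rightarrow> nat \<Rightarrow> dual" where
  "reciprocal t k = of_complex (t / of_nat k)"

lemma nested_root:
  assumes \<pi>: "\<pi> \<in> NC_on {1..n}" and B: "B \<in> \<pi>" "1 \<in> B" "n \<in> B"
  shows "nested \<pi> B = card \<pi>"
proof -
  have "Min B = 1" "Max B = n"
    using NC_on_block(1)[OF \<pi> B(1)] B NC_on_finite(2)[OF \<pi> _ B(1)]
    by (auto intro!: Min_eqI Max_eqI)
  then have "{U\<in>\<pi>. U \<subseteq> {Min B..Max B}} = \<pi>" using NC_on_block(1)[OF \<pi>] by auto
  then show ?thesis by (simp add: nested_def)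
qed

text \<open>A partition contributes t^|pi| divided by the product of all N(W). The root block has N
  = |pi|, so differentiation removes exactly its factor t / N and leaves the factors of the other
  blocks.\<close>

lemma irr_sum_derivative:
  "has_dual_derivative (\<lambda>t. irr_sum (reciprocal t) h xs) (\<lambda>t. irr_root (\<lambda>_. h) (reciprocal t) h xs)"
  unfolding irr_sum_def irr_root_def
proof (rule has_dual_derivative_sum)
  fix \<pi> assume "\<pi> \<in> NC_irr (length xs)"
  then obtain B where B: "B \<in> \<pi>" "1 \<in> B" "length xs \<in> B" and \<pi>: "\<pi> \<in> NC_on {1..length xs}"
    by (rule NC_irrD)
  have fin: "finite \<pi>" using NC_on_finite(1)[OF \<pi>] by simp
  then have pos: "card \<pi> > 0" using B by (auto simp: card_gt_0_iff)
  define c where "c = (\<Prod>W\<in>\<pi> - {B}. of_complex (1 / of_nat (nested \<pi> W)) * h (entries xs W))"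
  have rest: "(\<Prod>W\<in>\<pi> - {B}. reciprocal t (nested \<pi> W) * h (entries xs W)) =
      of_complex (t ^ (card \<pi> - 1)) * c" for t
  proof -
    have "reciprocal t k = of_complex t * of_complex (1 / of_nat k)" for k
      by (simp add: reciprocal_def of_complex_mult[symmetric])
    then show ?thesis
      using B fin
      by (simp add: c_def prod.distrib of_complex_power mult.assoc)
  qed
  have "weight (\<lambda>W k. reciprocal t k * h (entries xs W)) \<pi> =
      of_complex (t ^ card \<pi> / of_nat (card \<pi>)) * (h (entries xs B) * c)" for t
  proof -
    have "of_complex (t ^ card \<pi> / of_nat (card \<pi>)) =
        reciprocal t (card \<pi>) * of_complex (t ^ (card \<pi> - 1))"
      using pos by (simp add: power_eq_if reciprocal_def of_complex_mult[symmetric])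
    then show ?thesis
      unfolding weight_def prod.remove[OF fin B(1)] rest nested_root[OF \<pi> B]
      by (simp only: mult_ac)
  qed
  moreover have "weight (root_weight (\<lambda>_. h) (reciprocal t) h xs) \<pi> =
      of_complex (t ^ (card \<pi> - 1)) * (h (entries xs B) * c)" for t
  proof -
    have "1 \<notin> W" if "W \<in> \<pi> - {B}" for W
      using NC_on_same_block[OF \<pi> B(1), of W 1] that B by auto
    then have "(\<Prod>W\<in>\<pi> - {B}. root_weight (\<lambda>_. h) (reciprocal t) h xs W (nested \<pi> W)) =
        (\<Prod>W\<in>\<pi> - {B}. reciprocal t (nested \<pi> W) * h (entries xs W))"
      by (intro prod.cong) (auto simp: root_weight_def)
    then show ?thesis
      using B(2) by (simp add: weight_def prod.remove[OF fin B(1)] rest root_weight_def)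
  qed
  ultimately show "has_dual_derivative (\<lambda>t. weight (\<lambda>W k. reciprocal t k * h (entries xs W)) \<pi>)
      (\<lambda>t. weight (root_weight (\<lambda>_. h) (reciprocal t) h xs) \<pi>)"
    using has_dual_derivative_power[OF pos] by simp
qed

text \<open>Product rule on M = 1 + I M, with \<open>irr_sum_derivative\<close> for I. The
  assumption \<open>h [] = 0\<close> matches the constant value 1 at the empty word.\<close>

lemma nc_sum_derivative:
  assumes h: "h [] = 0"
  shows "has_dual_derivative (\<lambda>t. nc_sum (reciprocal t) h xs)
    (\<lambda>t. insertion (nc_sum (reciprocal t) h) (nc_sum (reciprocal t) h) h xs)"
proof (induction "length xs" arbitrary: xs rule: less_induct)
  case less
  let ?M = "\<lambda>t. nc_sum (reciprocal t) h"
  show ?case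
  proof (cases xs)
    case Nil
    then show ?thesis by (simp add: h has_dual_derivative_const)
  next
    case (Cons x ys)
    have "has_dual_derivative
      (\<lambda>t. conv (\<lambda>u. irr_sum (reciprocal t) h (x # u)) (?M t) ys)
      (\<lambda>t. conv (\<lambda>u. irr_root (\<lambda>_. h) (reciprocal t) h (x # u)) (?M t) ys +
        conv (\<lambda>u. irr_sum (reciprocal t) h (x # u)) (insertion (?M t) (?M t) h) ys)"
      using less Cons by (intro has_dual_derivative_conv irr_sum_derivative) auto
    \<comment> \<open>In the first term \<open>x\<close> is a letter handed to \<open>h\<close>, in
      the second it lies in the first gap; together they are the recursion for insertion at
      \<open>x # ys\<close>.\<close>
    moreover have "conv (\<lambda>u. irr_root (\<lambda>_. h) (reciprocal t) h (x # u)) (?M t) ys +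
        conv (\<lambda>u. irr_sum (reciprocal t) h (x # u)) (insertion (?M t) (?M t) h) ys =
      insertion (?M t) (?M t) h xs" for t
      using insertion_conv[of "\<lambda>u. irr_sum (reciprocal t) h (x # u)" "?M t" "?M t" h ys]
      by (simp add: Cons nc_root_Cons[symmetric] nc_root_insertion nc_sum_Cons)
    ultimately show ?thesis by (simp add: Cons nc_sum_Cons)
  qed
qed

lemma nc_sum_zero: "nc_sum (reciprocal 0) h xs = unit_fn xs"
proof (cases xs)
  case (Cons x ys)
  have "weight (\<lambda>W k. reciprocal 0 k * h (entries xs W)) \<pi> = 0" if \<pi>: "\<pi> \<in> NC (length xs)" for \<pi>
  proof -
    obtain B where "B \<in> \<pi>" using NC_first_block[OF \<pi>] Cons by auto
    moreover have "finite \<pi>" using NC_on_finite(1)[of \<pi> "{1..length xs}"] \<pi> by (simp add: NC_eq_NC_on)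
    ultimately show ?thesis
      by (auto simp: weight_def reciprocal_def of_complex_def zero_dual_def[symmetric] power_0_left)
  qed
  then show ?thesis using Cons by (simp add: nc_sum_def unit_fn_def)
qed (simp add: unit_fn_def)

text \<open>Both sides agree at t = 0 and have the same derivative in t.\<close>

lemma nc_sum_flow:
  assumes h: "h [] = 0"
  shows "insertion (nc_sum (reciprocal s) h) (nc_sum (reciprocal s) h) (nc_sum (reciprocal t) h) xs =
    nc_sum (reciprocal (s + t)) h xs"
proof (induction "length xs" arbitrary: xs t rule: less_induct)
  case less
  let ?M = "\<lambda>t. nc_sum (reciprocal t) h"
  let ?X = "\<lambda>t. insertion (?M s) (?M s) (?M t)"
  have "has_dual_derivative (\<lambda>t. ?X t xs) (\<lambda>t. insertion (?M s) (?M s) (insertion (?M t) (?M t) h) xs)"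
    by (intro has_dual_derivative_insertion nc_sum_derivative h)
  \<comment> \<open>Associativity gives T (T M_s M_t) h. Since \<open>h [] = 0\<close>, only gaps
    shorter than \<open>xs\<close> occur, and induction replaces T M_s M_t by M_(s+t) there.\<close>
  moreover have "insertion (?M s) (?M s) (insertion (?M t) (?M t) h) xs = insertion (?M (s + t)) (?M (s + t)) h xs" for t
    unfolding insertion_assoc using less by (intro insertion_cong_shorter h) auto
  ultimately have "has_dual_derivative (\<lambda>t. ?X t xs) (\<lambda>t. insertion (?M (s + t)) (?M (s + t)) h xs)"
    by simp
  moreover have "has_dual_derivative (\<lambda>t. ?M (s + t) xs) (\<lambda>t. insertion (?M (s + t)) (?M (s + t)) h xs)"
    by (rule has_dual_derivative_shift[OF nc_sum_derivative[of h xs, OF h]])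
  moreover have "?X 0 xs = ?M (s + 0) xs"
    using insertion_unit_right[of "?M s" "?M s" xs] by (simp add: nc_sum_zero[abs_def])
  ultimately show ?case by (rule has_dual_derivative_unique)
qed

section \<open>Comparison of cumulants sharing the same moments\<close>

lemma weight_one: "weight (\<lambda>W k. 1 * c (entries xs W)) \<pi> = mult_ext c \<pi> xs"
  by (simp add: weight_def mult_ext_def)

lemma weight_uminus: "weight (\<lambda>W k. 1 * (- c (entries xs W))) \<pi> = (-1) ^ card \<pi> * mult_ext c \<pi> xs"
  by (simp add: weight_def mult_ext_def prod_uminus)

lemma weight_reciprocal:
  "weight (\<lambda>W k. reciprocal t k * c (entries xs W)) \<pi> =
    of_complex (t ^ card \<pi> / of_nat (tree_factorial \<pi>)) * mult_ext c \<pi> xs"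
  by (simp add: weight_def mult_ext_def prod.distrib reciprocal_def of_complex_prod[symmetric]
      prod_dividef tree_factorial_def nested_def)

lemma cumulant_relations:
  fixes r b h :: "'a list \<Rightarrow> dual"
  assumes M_free: "M = nc_sum (\<lambda>_. 1) r"
    and M_boolean: "M = interval_sum b"
    and M_monotone: "M = nc_sum (reciprocal 1) h"
    and h: "h [] = 0"
    and xs: "xs \<noteq> []"
  shows "b xs = irr_sum (\<lambda>_. 1) r xs" "b xs = irr_sum (reciprocal 1) h xs"
    "r xs = - irr_sum (\<lambda>_. 1) (\<lambda>l. - b l) xs" "r xs = - irr_sum (reciprocal (-1)) h xs"
proof -
  have M0: "M [] = 1" by (simp add: M_free)
  have b: "M (x # ys) = conv (\<lambda>u. b (x # u)) M ys" for x ys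
    by (simp add: M_boolean interval_sum_Cons)
  have br: "b ys = irr_sum (\<lambda>_. 1) r ys" if "ys \<noteq> []" for ys
    using M0 b _ that by (rule boolean_unique) (simp add: M_free nc_sum_Cons)
  show "b xs = irr_sum (\<lambda>_. 1) r xs" using xs by (rule br)
  show "b xs = irr_sum (reciprocal 1) h xs"
    using M0 b _ xs by (rule boolean_unique) (simp add: M_monotone nc_sum_Cons)
  \<comment> \<open>Free moments of the family \<open>- b\<close>; they are the inverse of M for
    insertion.\<close>
  define N where "N = nc_sum (\<lambda>_. 1) (\<lambda>l. - b l)"
  have N0: "N [] = 1" by (simp add: N_def)
  have N_Cons: "N (x # ys) = insertion N N (\<lambda>u. - b (x # u)) ys" for x ys
    using nc_root_insertion[of "\<lambda>l. - b l" "\<lambda>_. 1" "\<lambda>l. - b l" x ys]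
    by (simp add: N_def nc_sum_root)
  have inv: "insertion M M N ys = unit_fn ys" for ys
    using M0 b N0 N_Cons by (rule insertion_inverse)
  have irr1: "irr_sum (\<lambda>_. 1) c = irr_root (\<lambda>_. c) (\<lambda>_. 1) c" for c :: "'a list \<Rightarrow> dual"
    by (simp add: irr_sum_root)
  show r: "r xs = - irr_sum (\<lambda>_. 1) (\<lambda>l. - b l) xs"
  proof (cases xs rule: rev_cases)
    case (snoc zs y)
    show ?thesis
    proof (cases zs)
      case Nil
      then show ?thesis using br[of xs] snoc by (simp add: irr1 irr_root_singleton)
    next
      case (Cons x ws)
      \<comment> \<open>With the outer letters x and y fixed, T M sends \<open>r\<close> to
        \<open>b\<close>; inserting the inverse N recovers \<open>r\<close>.\<close>
      have "r (x # ws @ [y]) = insertion N N (\<lambda>z. b (x # z @ [y])) ws"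
      proof (rule insertion_inject[where m = M, OF M0])
        fix zs
        have "insertion M M (insertion N N (\<lambda>z. b (x # z @ [y]))) zs = b (x # zs @ [y])"
          unfolding insertion_assoc inv[abs_def] by (rule insertion_unit_left)
        moreover have "insertion M M (\<lambda>zs. r (x # zs @ [y])) zs = b (x # zs @ [y])"
          by (simp add: br irr1 irr_root_insertion M_free)
        ultimately show "insertion M M (\<lambda>zs. r (x # zs @ [y])) zs =
          insertion M M (insertion N N (\<lambda>z. b (x # z @ [y]))) zs" by simp
      qed
      then show ?thesis
        by (simp add: snoc Cons irr1 irr_root_insertion N_def[symmetric] insertion_uminus_right)
    qed
  qed (use xs in simp)
  \<comment> \<open>Both are right inverses of M under insertion, since M = M_1 and the flow takes
    M_1 and M_(-1) to M_0, the unit; T M is injective.\<close>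
  have N_monotone: "N = nc_sum (reciprocal (-1)) h"
  proof
    fix ys
    show "N ys = nc_sum (reciprocal (-1)) h ys"
      by (rule insertion_inject[where m = M, OF M0])
        (simp add: inv, simp add: M_monotone nc_sum_flow[of h, OF h] nc_sum_zero)
  qed
  \<comment> \<open>Both are Boolean cumulants of the same moments N.\<close>
  have "irr_sum (\<lambda>_. 1) (\<lambda>l. - b l) xs = irr_sum (reciprocal (-1)) h xs"
  proof (rule boolean_unique[where m = N, OF N0 _ _ xs])
    fix x ys
    show "N (x # ys) = conv (\<lambda>u. irr_sum (\<lambda>_. 1) (\<lambda>l. - b l) (x # u)) N ys"
      unfolding N_def by (rule nc_sum_Cons)
    show "N (x # ys) = conv (\<lambda>u. irr_sum (reciprocal (-1)) h (x # u)) N ys"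
      unfolding N_monotone by (rule nc_sum_Cons)
  qed
  then show "r xs = - irr_sum (reciprocal (-1)) h xs" using r by simp
qed

section \<open>Application to the cumulants of the space\<close>

lemma NC_finite: "\<pi> \<in> NC n \<Longrightarrow> finite \<pi>"
  using NC_on_finite(1)[of \<pi> "{1..n}"] by (simp add: NC_eq_NC_on)

text \<open>An irreducible partition has at least one block, so the truncated
  \<open>card \<pi> - 1\<close> is a true predecessor.\<close>

lemma minus_one_power_card:
  assumes "\<pi> \<in> NC_irr n"
  shows "- ((-1) ^ card \<pi>) = ((-1) ^ (card \<pi> - 1) :: 'b::comm_ring_1)"
proof -
  obtain B where "B \<in> \<pi>" "\<pi> \<in> NC_on {1..n}" using NC_irrD[OF assms] by metis
  then have "card \<pi> \<noteq> 0" using NC_on_finite(1)[of \<pi> "{1..n}"] by auto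
  then show ?thesis by (cases "card \<pi>") auto
qed

theorem theorem5p1:
  fixes scale :: "complex \<Rightarrow> 'a::ring_1 \<Rightarrow> 'a"
    and \<phi> \<phi>' :: "'a \<Rightarrow> complex"
    and n :: nat
    and as :: "'a list"
  assumes "infinitesimal_ncps scale \<phi> \<phi>'"
    and "n \<ge> 1" and "length as = n"
  shows "dual_boolean_cumulant \<phi> \<phi>' as =
           (\<Sum>\<pi>\<in>NC_irr n. mult_ext (dual_free_cumulant \<phi> \<phi>') \<pi> as)
       \<and> dual_free_cumulant \<phi> \<phi>' as =
           (\<Sum>\<pi>\<in>NC_irr n. (-1) ^ (card \<pi> - 1) * mult_ext (dual_boolean_cumulant \<phi> \<phi>') \<pi> as)
       \<and> dual_boolean_cumulant \<phi> \<phi>' as =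
           (\<Sum>\<pi>\<in>NC_irr n. of_complex (1 / of_nat (tree_factorial \<pi>)) *
              mult_ext (dual_monotone_cumulant \<phi> \<phi>') \<pi> as)
       \<and> dual_free_cumulant \<phi> \<phi>' as =
           (\<Sum>\<pi>\<in>NC_irr n. of_complex ((-1) ^ (card \<pi> - 1) / of_nat (tree_factorial \<pi>)) *
              mult_ext (dual_monotone_cumulant \<phi> \<phi>') \<pi> as)"
proof -
  interpret infinitesimal_ncps scale \<phi> \<phi>' by fact
  let ?r = "dual_free_cumulant \<phi> \<phi>'" and ?b = "dual_boolean_cumulant \<phi> \<phi>'"
    and ?h = "dual_monotone_cumulant \<phi> \<phi>'"
  let ?m = "\<lambda>xs. Dual (\<phi> (prod_list xs)) (\<phi>' (prod_list xs))"
  \<comment> \<open>The moment-cumulant formulas cover nonempty words; at the empty word the values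
    1 and 0 at the unit give the dual number 1.\<close>
  have moment_eqI: "?m = F" if "\<And>xs. length xs \<ge> 1 \<Longrightarrow> ?m xs = F xs" "F [] = 1" for F
  proof
    fix xs show "?m xs = F xs"
      by (cases "xs = []") (simp_all add: that phi_one phi'_one one_dual_def Suc_le_eq)
  qed
  \<comment> \<open>The formulas for \<open>\<phi>\<close> and \<open>\<phi>'\<close> are the two
    components of a single dual formula, by \<open>mult_ext_Dual\<close>.\<close>
  have free: "?m = nc_sum (\<lambda>_. 1) ?r"
  proof (rule moment_eqI)
    fix xs :: "'a list" assume "length xs \<ge> 1"
    then show "?m xs = nc_sum (\<lambda>_. 1) ?r xs"
      unfolding nc_sum_def weight_one
      by (simp add: dual_free_cumulant_def[abs_def] mult_ext_Dual NC_finite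
          sum_Dual free_moment_cumulant[OF _ refl, where \<phi> = \<phi>]
          inf_free_moment_cumulant[OF _ refl, where \<phi> = \<phi> and \<phi>' = \<phi>'])
  qed simp
  have boolean: "?m = interval_sum ?b"
  proof (rule moment_eqI)
    fix xs :: "'a list" assume "length xs \<ge> 1"
    moreover have "finite \<pi>" if "\<pi> \<in> interval_partitions (length xs)" for \<pi>
      using that interval_partitions_subset_NC NC_finite by blast
    ultimately show "?m xs = interval_sum ?b xs"
      by (simp add: interval_sum_def dual_boolean_cumulant_def[abs_def] mult_ext_Dual
          sum_Dual boolean_moment_cumulant[OF _ refl, where \<phi> = \<phi>]
          inf_boolean_moment_cumulant[OF _ refl, where \<phi> = \<phi> and \<phi>' = \<phi>'])
  qed simp
  have monotone: "?m = nc_sum (reciprocal 1) ?h"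
  proof (rule moment_eqI)
    fix xs :: "'a list" assume "length xs \<ge> 1"
    then show "?m xs = nc_sum (reciprocal 1) ?h xs"
      unfolding nc_sum_def weight_reciprocal
      by (simp add: dual_monotone_cumulant_def[abs_def] mult_ext_Dual NC_finite
          of_complex_mult_Dual sum_Dual monotone_moment_cumulant[OF _ refl, where \<phi> = \<phi>]
          inf_monotone_moment_cumulant[OF _ refl, where \<phi> = \<phi> and \<phi>' = \<phi>'])
  qed simp
  \<comment> \<open>On the empty word the recursion subtracts the term of the empty partition, which
    differs from the excluded \<open>{{1..0}}\<close>; the components are 1 - 1 and 0 - 0.\<close>
  have "NC 0 = {{}}"
    by (auto simp: NC_def partition_on_empty)
  then have h: "?h [] = 0"
    by (simp add: dual_monotone_cumulant_def monotone_cumulant.simps[of _ "[]"] inf_monotone_cumulant.simps[of _ _ "[]"]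
        mult_ext_def partial_ext_def tree_factorial_def phi_one phi'_one zero_dual_def)
  have as: "as \<noteq> []" using assms by auto
  note rel = cumulant_relations[OF free boolean monotone h as]
  have n: "length as = n" by fact
  have "?b as = (\<Sum>\<pi>\<in>NC_irr n. mult_ext ?r \<pi> as)"
    by (simp only: rel(1) irr_sum_def weight_one n)
  moreover have "?r as = (\<Sum>\<pi>\<in>NC_irr n. (-1) ^ (card \<pi> - 1) * mult_ext ?b \<pi> as)"
    unfolding rel(3) irr_sum_def weight_uminus n sum_negf[symmetric] mult_minus_left[symmetric]
    by (intro sum.cong refl) (simp only: minus_one_power_card)
  moreover have "?b as = (\<Sum>\<pi>\<in>NC_irr n. of_complex (1 / of_nat (tree_factorial \<pi>)) * mult_ext ?h \<pi> as)"
    unfolding rel(2) irr_sum_def weight_reciprocal n by simp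
  moreover have "?r as = (\<Sum>\<pi>\<in>NC_irr n. of_complex ((-1) ^ (card \<pi> - 1) / of_nat (tree_factorial \<pi>)) *
      mult_ext ?h \<pi> as)"
    unfolding rel(4) irr_sum_def weight_reciprocal n sum_negf[symmetric]
  proof (rule sum.cong)
    fix \<pi> assume \<pi>: "\<pi> \<in> NC_irr n"
    have "(-1) ^ (card \<pi> - 1) / of_nat (tree_factorial \<pi>) =
        (- ((-1) ^ card \<pi> / of_nat (tree_factorial \<pi>)) :: complex)"
      unfolding minus_one_power_card[OF \<pi>, symmetric] by simp
    moreover have "of_complex (- c) * d = - (of_complex c * d)" for c d
      by (simp add: dual.expand)
    ultimately show "- (of_complex ((-1) ^ card \<pi> / of_nat (tree_factorial \<pi>)) * mult_ext ?h \<pi> as) =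
      of_complex ((-1) ^ (card \<pi> - 1) / of_nat (tree_factorial \<pi>)) * mult_ext ?h \<pi> as"
      by simp
  qed simp
  ultimately show ?thesis by blast
qed

end
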